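(* For each $N$ let $(X_n)_{n\ge 0}$ be the edge-counting process of the growing random graph with $N$ vertices. As $N\to\infty$, the process $\left(X_{\lfloor tN^{1/3}\rfloor},~t\ge 0\right)$ converges weakly in the Skorohod space $D[0,\infty)$ to a nonhomogeneous Poisson (counting) process with rate function $\lambda(t)=t^2/2$, $t>0$.
   Context: Growing random graph. Fix $N$. Initially there is a pool of $N$ virtual vertices and no edges. At each step, an element is selected uniformly at random from the current pool of virtual elements (vertices and edges), removed from the pool, and declared occupied. When the $n$-th vertex becomes occupied (it is then labelled $n$), the $n-1$ edges linking it to the previously occupied vertices $1,\dots,n-1$ are added to the pool as virtual edges. Thus when there are $n$ occupied vertices and $k$ occupied edges, the pool consists of $N-n$ virtual vertices and $\binom n2-k$ virtual edges. The process continues until the pool is empty (complete graph on $N$ vertices). For $1\le n\le N$, $X_n$ is the number of occupied edges at the moment the $n$-th vertex becomes occupied; $X_0=0$; and for $n>N$ set $X_n:=\binom N2$. The law of $(X_n)$ depends on $N$. Equivalently, $(X_n)_{0\le n\le N}$ is a Markov chain with $X_0=X_1=0$ such that, for $1\le n<N$, given $X_n=k$, the increment $X_{n+1}-X_n$ is the number of black balls drawn before the first white ball when sampling uniformly without replacement from an urn with $\binom n2-k$ black and $N-n$ white balls. *)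

theory Defs
  imports "HOL-Probability.Probability"
begin

section \<open>The growing random graph\<close>

datatype item = Vertex nat | Edge "nat set"

text \<open>
  A run of the process is recorded as the list \<open>h\<close> of the items occupied so far, oldest first.
  The vertices are \<open>0, \<dots>, N - 1\<close>; an edge is available as soon as both of its end points
  are occupied.
\<close>

definition pool :: "nat \<Rightarrow> item list \<Rightarrow> item set" where
  "pool N h =
     (Vertex ` {..<N} \<union>
      {Edge {u, v} | u v. u \<noteq> v \<and> Vertex u \<in> set h \<and> Vertex v \<in> set h}) - set h"

primrec history :: "nat \<Rightarrow> nat \<Rightarrow> item list pmf" where
  "history N 0 = return_pmf []"
| "history N (Suc m) =
     do { h \<leftarrow> history N m;
          if pool N h = {} then return_pmf h
          else do { x \<leftarrow> pmf_of_set (pool N h); return_pmf (h @ [x]) } }"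

text \<open>Every run empties the pool after exactly \<open>N + (N choose 2)\<close> steps.\<close>

definition full_history :: "nat \<Rightarrow> item list pmf" where
  "full_history N = history N (N + (N choose 2))"

definition vertex_count :: "item list \<Rightarrow> nat" where
  "vertex_count h = length (filter (\<lambda>x. \<exists>v. x = Vertex v) h)"

definition edge_count :: "item list \<Rightarrow> nat" where
  "edge_count h = length (filter (\<lambda>x. \<exists>e. x = Edge e) h)"

definition occupation_time :: "nat \<Rightarrow> item list \<Rightarrow> nat" where
  "occupation_time n h = (LEAST m. n \<le> vertex_count (take m h))"

definition edges_at :: "nat \<Rightarrow> nat \<Rightarrow> item list \<Rightarrow> nat" where
  "edges_at N n h =
     (if n = 0 then 0
      else if n \<le> N then edge_count (take (occupation_time n h) h)
      else N choose 2)"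

section \<open>The Skorohod space of real-valued paths on the half-line\<close>

text \<open>Paths are normalised to be \<open>undefined\<close> at negative times, so that equality of paths is
  equality on \<open>{0..}\<close>.\<close>

definition skorohod_paths :: "(real \<Rightarrow> real) set" where
  "skorohod_paths =
     {x \<in> extensional {0..}.
        (\<forall>t\<ge>0. (x \<longlongrightarrow> x t) (at_right t)) \<and> (\<forall>t>0. \<exists>l. (x \<longlongrightarrow> l) (at_left t))}"

definition time_changes :: "real \<Rightarrow> (real \<Rightarrow> real) set" where
  "time_changes T =
     {l. strict_mono_on {0..T} l \<and> continuous_on {0..T} l \<and> l ` {0..T} = {0..T}}"

text \<open>
  The \<open>J\<^sub>1\<close> distance on \<open>[0, T]\<close>, truncated at \<open>1\<close>. Having \<open>1\<close> in the set
  also keeps the infimum meaningful for arbitrary (possibly unbounded) functions.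
\<close>

definition skorohod_dist_upto :: "real \<Rightarrow> (real \<Rightarrow> real) \<Rightarrow> (real \<Rightarrow> real) \<Rightarrow> real" where
  "skorohod_dist_upto T x y =
     Inf (insert 1 {e. 0 < e \<and>
       (\<exists>l\<in>time_changes T. \<forall>t\<in>{0..T}. \<bar>l t - t\<bar> \<le> e \<and> \<bar>x t - y (l t)\<bar> \<le> e)})"

text \<open>
  The distance on \<open>[0, \<infinity>)\<close> follows Billingsley, \<^emph>\<open>Convergence of Probability Measures\<close>
  (2nd ed., Section 16): paths are multiplied by the function that is \<open>1\<close> up to \<open>m - 1\<close>,
  decreases linearly and vanishes from \<open>m\<close> on, so that jumps near the cut-off are harmless.
\<close>

definition taper :: "real \<Rightarrow> (real \<Rightarrow> real) \<Rightarrow> real \<Rightarrow> real" where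
  "taper m x t = max 0 (min 1 (m - t)) * x t"

definition skorohod_dist :: "(real \<Rightarrow> real) \<Rightarrow> (real \<Rightarrow> real) \<Rightarrow> real" where
  "skorohod_dist x y =
     (\<Sum>k. (1/2) ^ Suc k *
        skorohod_dist_upto (real (Suc k)) (taper (real (Suc k)) x) (taper (real (Suc k)) y))"

definition skorohod_topology :: "(real \<Rightarrow> real) topology" where
  "skorohod_topology = Metric_space.mtopology skorohod_paths skorohod_dist"

lemma time_change_inverse:
  assumes l: "l \<in> time_changes T"
  shows "inv_into {0..T} l \<in> time_changes T"
    and "\<And>t. t \<in> {0..T} \<Longrightarrow> l (inv_into {0..T} l t) = t"
    and "\<And>t. t \<in> {0..T} \<Longrightarrow> inv_into {0..T} l t \<in> {0..T}"
proof -
  have mono: "strict_mono_on {0..T} l" and cont: "continuous_on {0..T} l"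
    and im: "l ` {0..T} = {0..T}"
    using l by (auto simp: time_changes_def)
  have inj: "inj_on l {0..T}"
    using mono by (rule strict_mono_on_imp_inj_on)
  show r: "l (inv_into {0..T} l t) = t" if "t \<in> {0..T}" for t
    using that im by (metis f_inv_into_f)
  show m: "inv_into {0..T} l t \<in> {0..T}" if "t \<in> {0..T}" for t
    using that im by (metis inv_into_into)
  have "strict_mono_on {0..T} (inv_into {0..T} l)"
  proof (rule strict_mono_onI)
    fix s t assume st: "s \<in> {0..T}" "t \<in> {0..T}" "s < t"
    show "inv_into {0..T} l s < inv_into {0..T} l t"
      using r[OF st(1)] r[OF st(2)] m[OF st(1)] m[OF st(2)] st(3)
        strict_mono_on_less_eq[OF mono m[OF st(2)] m[OF st(1)]] by linarith
  qed
  moreover have "continuous_on {0..T} (inv_into {0..T} l)"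
    using continuous_on_inv[OF cont, of "inv_into {0..T} l"] inj im by simp
  moreover have "inv_into {0..T} l ` {0..T} = {0..T}"
    using inv_into_image_cancel[OF inj, of "{0..T}"] im by simp
  ultimately show "inv_into {0..T} l \<in> time_changes T"
    by (simp add: time_changes_def)
qed

lemma time_change_compose:
  assumes "l \<in> time_changes T" "k \<in> time_changes T"
  shows "k \<circ> l \<in> time_changes T"
proof -
  have lm: "l t \<in> {0..T}" if "t \<in> {0..T}" for t
    using assms(1) that by (auto simp: time_changes_def)
  have "strict_mono_on {0..T} (k \<circ> l)"
    using assms lm by (auto simp: time_changes_def strict_mono_on_def)
  moreover have "continuous_on {0..T} (k \<circ> l)"
    using assms by (intro continuous_on_compose) (auto simp: time_changes_def)
  moreover have "(k \<circ> l) ` {0..T} = {0..T}"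
    using assms by (simp add: time_changes_def flip: image_image image_comp)
  ultimately show ?thesis by (simp add: time_changes_def)
qed

lemma skorohod_dist_upto_le:
  assumes "l \<in> time_changes T" "0 < e"
    "\<And>t. t \<in> {0..T} \<Longrightarrow> \<bar>l t - t\<bar> \<le> e \<and> \<bar>x t - y (l t)\<bar> \<le> e"
  shows "skorohod_dist_upto T x y \<le> e"
  unfolding skorohod_dist_upto_def
  by (rule cInf_lower) (use assms in \<open>auto intro!: bdd_belowI[of _ 0] bexI[of _ l]\<close>)

lemma skorohod_dist_upto_le1: "skorohod_dist_upto T x y \<le> 1"
  unfolding skorohod_dist_upto_def
  by (rule cInf_lower) (auto intro!: bdd_belowI[of _ 0])

lemma skorohod_dist_upto_nonneg: "0 \<le> skorohod_dist_upto T x y"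
  unfolding skorohod_dist_upto_def by (rule cInf_greatest) auto

lemma skorohod_dist_upto_lessE:
  assumes "skorohod_dist_upto T x y < e" "e \<le> 1"
  obtains d l where "0 < d" "d < e" "l \<in> time_changes T"
    "\<And>t. t \<in> {0..T} \<Longrightarrow> \<bar>l t - t\<bar> \<le> d \<and> \<bar>x t - y (l t)\<bar> \<le> d"
proof -
  define S where "S = insert 1 {e. 0 < e \<and>
       (\<exists>l\<in>time_changes T. \<forall>t\<in>{0..T}. \<bar>l t - t\<bar> \<le> e \<and> \<bar>x t - y (l t)\<bar> \<le> e)}"
  have "Inf S < e" using assms(1) by (simp add: skorohod_dist_upto_def S_def)
  moreover have "S \<noteq> {}" by (simp add: S_def)
  ultimately obtain d where "d \<in> S" "d < e"
    using cInf_lessD by blast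
  then show ?thesis using assms(2) that by (auto simp: S_def)
qed

lemma skorohod_dist_upto_commute_le: "skorohod_dist_upto T y x \<le> skorohod_dist_upto T x y"
proof (rule dense_ge)
  fix e assume e: "skorohod_dist_upto T x y < e"
  show "skorohod_dist_upto T y x \<le> e"
  proof (cases "e \<le> 1")
    case True
    with e obtain d l where d: "0 < d" "d < e" and l: "l \<in> time_changes T"
      and b: "\<And>t. t \<in> {0..T} \<Longrightarrow> \<bar>l t - t\<bar> \<le> d \<and> \<bar>x t - y (l t)\<bar> \<le> d"
      by (rule skorohod_dist_upto_lessE) blast
    have "skorohod_dist_upto T y x \<le> d"
    proof (rule skorohod_dist_upto_le[OF time_change_inverse(1)[OF l] d(1)])
      fix t assume t: "t \<in> {0..T}"
      show "\<bar>inv_into {0..T} l t - t\<bar> \<le> d \<and> \<bar>y t - x (inv_into {0..T} l t)\<bar> \<le> d"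
        using b[OF time_change_inverse(3)[OF l t]] time_change_inverse(2)[OF l t]
        by (simp add: abs_minus_commute)
    qed
    then show ?thesis using d by linarith
  qed (use skorohod_dist_upto_le1[of T y x] in linarith)
qed

lemma skorohod_dist_upto_commute: "skorohod_dist_upto T x y = skorohod_dist_upto T y x"
  by (intro antisym skorohod_dist_upto_commute_le)

lemma skorohod_dist_upto_triangle:
  "skorohod_dist_upto T x z \<le> skorohod_dist_upto T x y + skorohod_dist_upto T y z"
proof (rule dense_ge)
  fix e assume "skorohod_dist_upto T x y + skorohod_dist_upto T y z < e"
  then obtain a b where ab: "skorohod_dist_upto T x y < a" "skorohod_dist_upto T y z < b"
      "a + b = e"
    by (metis add.commute add_diff_cancel_left' less_diff_eq dense diff_add_cancel diff_less_eq)
  show "skorohod_dist_upto T x z \<le> e"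
  proof (cases "a \<le> 1 \<and> b \<le> 1")
    case True
    obtain d l where d: "0 < d" "d < a" and l: "l \<in> time_changes T"
      and b1: "\<And>t. t \<in> {0..T} \<Longrightarrow> \<bar>l t - t\<bar> \<le> d \<and> \<bar>x t - y (l t)\<bar> \<le> d"
      using ab True by (metis skorohod_dist_upto_lessE)
    obtain d' l' where d': "0 < d'" "d' < b" and l': "l' \<in> time_changes T"
      and b2: "\<And>t. t \<in> {0..T} \<Longrightarrow> \<bar>l' t - t\<bar> \<le> d' \<and> \<bar>y t - z (l' t)\<bar> \<le> d'"
      using ab True by (metis skorohod_dist_upto_lessE)
    have "skorohod_dist_upto T x z \<le> d + d'"
    proof (rule skorohod_dist_upto_le[OF time_change_compose[OF l l']])
      fix t assume t: "t \<in> {0..T}"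
      then have "l t \<in> {0..T}" using l by (auto simp: time_changes_def)
      then show "\<bar>(l' \<circ> l) t - t\<bar> \<le> d + d' \<and> \<bar>x t - z ((l' \<circ> l) t)\<bar> \<le> d + d'"
        using b1[OF t] b2[of "l t"] by auto
    qed (use d d' in simp)
    then show ?thesis using d d' ab by linarith
  next
    case False
    then show ?thesis
      using ab skorohod_dist_upto_le1[of T x z] skorohod_dist_upto_nonneg[of T x y]
        skorohod_dist_upto_nonneg[of T y z] by linarith
  qed
qed

lemma skorohod_dist_upto_eq_0:
  assumes "skorohod_dist_upto T x y = 0" "0 \<le> t" "t < T"
    and x: "(x \<longlongrightarrow> x t) (at_right t)" and y: "(y \<longlongrightarrow> y t) (at_right t)"
  shows "x t = y t"
proof (rule ccontr)
  assume neq: "x t \<noteq> y t"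
  define h where "h = \<bar>x t - y t\<bar> / 3"
  have h: "0 < h" using neq by (simp add: h_def)
  have "\<forall>\<^sub>F s in at_right t. dist (x s) (x t) < h \<and> dist (y s) (y t) < h"
    using tendstoD[OF x h] tendstoD[OF y h] by eventually_elim simp
  then obtain b where b: "b > t"
    and near: "\<And>s. t < s \<Longrightarrow> s < b \<Longrightarrow> dist (x s) (x t) < h \<and> dist (y s) (y t) < h"
    using \<open>t < T\<close> by (auto simp: eventually_at_right_field)
  define c where "c = min b T"
  define u where "u = (t + c) / 2"
  have c: "t < c" "c \<le> b" "c \<le> T" using b assms by (auto simp: c_def)
  define e where "e = min 1 (min h ((c - t) / 2))"
  have "0 < e" using h c by (simp add: e_def)
  then obtain d l where d: "0 < d" "d < e"
    and l: "\<And>t. t \<in> {0..T} \<Longrightarrow> \<bar>l t - t\<bar> \<le> d \<and> \<bar>x t - y (l t)\<bar> \<le> d"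
    using skorohod_dist_upto_lessE[of T x y e] assms(1) unfolding e_def
    by (metis min.cobounded1)
  have "u \<in> {0..T}" using c assms by (auto simp: u_def)
  from l[OF this] d have lu: "\<bar>l u - u\<bar> < (c - t) / 2" "\<bar>x u - y (l u)\<bar> < h"
    by (auto simp: e_def)
  have "t < l u" "l u < c" using lu(1) unfolding u_def abs_less_iff by (auto simp: field_simps)
  moreover have "t < u" "u < c" using c by (auto simp: u_def field_simps)
  ultimately have "dist (x u) (x t) < h" "dist (y (l u)) (y t) < h"
    using near c by (meson less_le_trans)+
  with lu(2) have "\<bar>x t - y t\<bar> < 3 * h"
    by (simp add: dist_real_def)
  then show False by (simp add: h_def)
qed

lemma summable_skorohod_dist:
  "summable (\<lambda>k. (1/2) ^ Suc k *
     skorohod_dist_upto (real (Suc k)) (taper (real (Suc k)) x) (taper (real (Suc k)) y))"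
proof (rule summable_comparison_test')
  show "summable (\<lambda>k. (1/2::real) ^ Suc k)"
    using summable_mult[OF summable_geometric[of "1/2::real"], of "1/2"] by simp
  show "norm ((1/2) ^ Suc k *
     skorohod_dist_upto (real (Suc k)) (taper (real (Suc k)) x) (taper (real (Suc k)) y))
      \<le> (1/2) ^ Suc k" for k
    using skorohod_dist_upto_nonneg skorohod_dist_upto_le1
    by (simp add: abs_mult mult_left_le)
qed

lemma Metric_space_skorohod: "Metric_space skorohod_paths skorohod_dist"
proof
  fix x y z :: "real \<Rightarrow> real"
  show nonneg: "0 \<le> skorohod_dist x y"
    unfolding skorohod_dist_def
    by (intro suminf_nonneg summable_skorohod_dist mult_nonneg_nonneg
        skorohod_dist_upto_nonneg) simp
  show "skorohod_dist x y = skorohod_dist y x"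
    by (simp only: skorohod_dist_def skorohod_dist_upto_commute[of _ "taper _ x"])
  show "skorohod_dist x z \<le> skorohod_dist x y + skorohod_dist y z"
    unfolding skorohod_dist_def suminf_add[OF summable_skorohod_dist summable_skorohod_dist]
    by (intro suminf_le summable_skorohod_dist summable_add)
      (simp add: skorohod_dist_upto_triangle flip: distrib_left)
  assume xy: "x \<in> skorohod_paths" "y \<in> skorohod_paths"
  show "skorohod_dist x y = 0 \<longleftrightarrow> x = y"
  proof
    assume "skorohod_dist x y = 0"
    then have z: "skorohod_dist_upto (real (Suc k))
        (taper (real (Suc k)) x) (taper (real (Suc k)) y) = 0" for k
      unfolding skorohod_dist_def
      by (subst (asm) suminf_eq_zero_iff[OF summable_skorohod_dist])
        (auto intro!: mult_nonneg_nonneg skorohod_dist_upto_nonneg)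
    have "x t = y t" if t: "0 \<le> t" for t
    proof -
      obtain k :: nat where k: "t + 1 < real k" using reals_Archimedean2 by blast
      define m where "m = real (Suc k)"
      have lim: "(taper m w \<longlongrightarrow> taper m w t) (at_right t)" if "w \<in> skorohod_paths" for w
        using that t unfolding taper_def skorohod_paths_def
        by (auto intro!: tendsto_intros)
      have "taper m x t = taper m y t"
        by (rule skorohod_dist_upto_eq_0[OF z[of k, folded m_def] t])
          (use k lim xy in \<open>auto simp: m_def\<close>)
      then show ?thesis using k by (simp add: taper_def m_def)
    qed
    then show "x = y"
      using xy by (intro extensionalityI[of x "{0..}"]) (auto simp: skorohod_paths_def)
  next
    assume "x = y"
    have "skorohod_dist_upto T w w = 0" for T w
    proof (rule antisym[OF dense_ge skorohod_dist_upto_nonneg])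
      fix e :: real assume "0 < e"
      then show "skorohod_dist_upto T w w \<le> e"
        by (intro skorohod_dist_upto_le[of "\<lambda>t. t"])
          (auto simp: time_changes_def strict_mono_on_def)
    qed
    then show "skorohod_dist x y = 0"
      by (simp add: skorohod_dist_def \<open>x = y\<close>)
  qed
qed

section \<open>Weak convergence of laws on a topological space\<close>

definition borel_of :: "'a topology \<Rightarrow> 'a measure" where
  "borel_of T = sigma (topspace T) {U. openin T U}"

definition weak_convergence ::
  "'a topology \<Rightarrow> (nat \<Rightarrow> 'a measure) \<Rightarrow> 'a measure \<Rightarrow> bool" where
  "weak_convergence T P Q \<longleftrightarrow>
     (\<forall>n. prob_space (P n) \<and> sets (P n) = sets (borel_of T)) \<and>
     prob_space Q \<and> sets Q = sets (borel_of T) \<and>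
     (\<forall>f. continuous_map T euclideanreal f \<and> bounded (f ` topspace T) \<longrightarrow>
        (\<lambda>n. integral\<^sup>L (P n) f) \<longlonglongrightarrow> integral\<^sup>L Q f)"

section \<open>Nonhomogeneous Poisson processes\<close>

locale nonhomogeneous_poisson_process = prob_space M for M :: "'a measure" +
  fixes rate :: "real \<Rightarrow> real" and Y :: "real \<Rightarrow> 'a \<Rightarrow> nat"
  assumes rate_nonneg: "\<And>t. 0 < t \<Longrightarrow> 0 \<le> rate t"
    and rate_integrable: "\<And>t. 0 \<le> t \<Longrightarrow> rate integrable_on {0..t}"
    and random_variable: "\<And>t. 0 \<le> t \<Longrightarrow> Y t \<in> M \<rightarrow>\<^sub>M count_space UNIV"
    and starts_at_0: "\<And>\<omega>. \<omega> \<in> space M \<Longrightarrow> Y 0 \<omega> = 0"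
    and nondecreasing: "\<And>\<omega>. \<omega> \<in> space M \<Longrightarrow> mono_on {0..} (\<lambda>t. Y t \<omega>)"
    and right_continuous:
      "\<And>\<omega> t. \<omega> \<in> space M \<Longrightarrow> 0 \<le> t \<Longrightarrow> ((\<lambda>s. real (Y s \<omega>)) \<longlongrightarrow> real (Y t \<omega>)) (at_right t)"
    and independent_increments:
      "\<And>(n::nat) (t::nat \<Rightarrow> real). 0 \<le> t 0 \<Longrightarrow> mono t \<Longrightarrow>
         indep_vars (\<lambda>_. count_space UNIV) (\<lambda>i \<omega>. Y (t (Suc i)) \<omega> - Y (t i) \<omega>) {..<n}"
    and poisson_increments:
      "\<And>s t k. 0 \<le> s \<Longrightarrow> s \<le> t \<Longrightarrow>
         prob {\<omega> \<in> space M. Y t \<omega> - Y s \<omega> = k}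
           = integral {s..t} rate ^ k / fact k * exp (- integral {s..t} rate)"

section \<open>The path-valued random elements\<close>

definition rescaled_edge_path :: "nat \<Rightarrow> item list \<Rightarrow> real \<Rightarrow> real" where
  "rescaled_edge_path N h = (\<lambda>t\<in>{0..}. real (edges_at N (nat \<lfloor>t * root 3 (real N)\<rfloor>) h))"

definition edge_process_law :: "nat \<Rightarrow> (real \<Rightarrow> real) measure" where
  "edge_process_law N =
     distr (measure_pmf (full_history N)) (borel_of skorohod_topology) (rescaled_edge_path N)"

definition path_law :: "'a measure \<Rightarrow> (real \<Rightarrow> 'a \<Rightarrow> nat) \<Rightarrow> (real \<Rightarrow> real) measure" where
  "path_law M Y =
     distr M (borel_of skorohod_topology) (\<lambda>\<omega>. \<lambda>t\<in>{0..}. real (Y t \<omega>))"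

end

theory Submission
  imports Defs "HOL-Real_Asymp.Real_Asymp"
begin

text \<open>
  Let \<open>a = N\<^sup>1\<^sup>/\<^sup>3\<close>. Sampling the Poisson process \<open>Y\<close> at the times \<open>i / a\<close>, \<open>i \<le> L\<close>, with
  \<open>L = N\<^sup>1\<^sup>1\<^sup>/\<^sup>3\<^sup>0\<close>, yields paths that converge to \<open>Y\<close> in the Skorohod metric for every outcome, and both
  the sampled \<open>Y\<close> and \<open>(X\<^sub>i)\<close> are with high probability described by the set \<open>B\<close> of indices at
  which they increase by one. For every sparse \<open>B\<close>, the probability that \<open>X\<close> follows \<open>B\<close> is at
  least \<open>1 - o(1)\<close> times the probability that \<open>Y\<close> does, uniformly in \<open>B\<close>. Hence
  \<open>liminf E f(X) \<ge> E f(Y)\<close> for bounded continuous \<open>f \<ge> 0\<close>. Applying this to \<open>C + f\<close> and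
  \<open>C - f\<close> gives convergence, so no matching upper bounds on the probabilities are needed.
\<close>

section \<open>Sampled counting paths in the Skorohod space\<close>

text \<open>The obstacle is that \<open>f\<close> is merely continuous in the Skorohod metric, while
  a pattern \<open>B\<close> describes the rescaled \<open>X\<close> only up to time L / a. So
  \<open>f\<close> is replaced by its infimum over a shrinking ball around the pattern path. This
  lower envelope depends on \<open>B\<close> alone, hence can be summed against the pattern
  probabilities of either process, and along the sampled paths of \<open>Y\<close> it tends to
  \<open>f\<close> for every outcome, so that dominated convergence applies. Sparseness has two
  sides. The chance that the next item is an edge matches the Poisson mean of a cell only up to a
  relative error of order 1/i + k/i^2 + L^2/N, so indices below a cutoff \<open>I\<close> are
  excluded. Under the Poisson law all remaining outcomes are negligible. The grid of mesh 1/a is the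
  natural one: the rescaled path of \<open>X\<close> is constant on its cells, so only
  \<open>Y\<close> has to be discretised.\<close>

lemma step_path_in_skorohod_paths:
  fixes F :: "nat \<Rightarrow> real"
  assumes "0 \<le> a"
  shows "(\<lambda>t\<in>{0..}. F (nat \<lfloor>t * a\<rfloor>)) \<in> skorohod_paths"
proof (cases "a = 0")
  case True
  then show ?thesis
  proof -
    have "((\<lambda>t\<in>{0..}. F 0) \<longlongrightarrow> F 0) (at_right t)" if "0 \<le> t" for t :: real
      unfolding restrict_def using that
      by (intro tendsto_eventually) (auto simp: eventually_at_right_field intro!: exI[of _ "t + 1"])
    moreover have "((\<lambda>t\<in>{0..}. F 0) \<longlongrightarrow> F 0) (at_left t)" if "0 < t" for t :: real
      unfolding restrict_def using that
      by (intro tendsto_eventually) (auto simp: eventually_at_left_field intro!: exI[of _ 0])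
    ultimately show ?thesis using True by (auto simp: skorohod_paths_def)
  qed
next
  case False
  with assms have a: "0 < a" by simp
  have "((\<lambda>t\<in>{0..}. F (nat \<lfloor>t * a\<rfloor>)) \<longlongrightarrow> F (nat \<lfloor>t * a\<rfloor>)) (at_right t)" if "0 \<le> t" for t
  proof (rule tendsto_eventually)
    have "t * a < of_int \<lfloor>t * a\<rfloor> + 1" by linarith
    then have "t < (of_int \<lfloor>t * a\<rfloor> + 1) / a" using a by (simp add: pos_less_divide_eq)
    moreover have "(\<lambda>t\<in>{0..}. F (nat \<lfloor>t * a\<rfloor>)) s = F (nat \<lfloor>t * a\<rfloor>)"
      if "t < s" "s < (of_int \<lfloor>t * a\<rfloor> + 1) / a" for s
    proof -
      have "t * a \<le> s * a" "s * a < of_int \<lfloor>t * a\<rfloor> + 1" using that a by (auto simp: field_simps)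
      then have "\<lfloor>s * a\<rfloor> = \<lfloor>t * a\<rfloor>" by linarith
      then show ?thesis using that \<open>0 \<le> t\<close> by simp
    qed
    ultimately show "\<forall>\<^sub>F s in at_right t. (\<lambda>t\<in>{0..}. F (nat \<lfloor>t * a\<rfloor>)) s = F (nat \<lfloor>t * a\<rfloor>)"
      unfolding eventually_at_right_field by blast
  qed
  \<comment> \<open>Just to the left of \<open>t\<close> the index is
    \<open>\<lceil>t * a\<rceil> - 1\<close>, also when \<open>t * a\<close> is an integer and the
    index changes at \<open>t\<close> itself.\<close>
  moreover have "((\<lambda>t\<in>{0..}. F (nat \<lfloor>t * a\<rfloor>)) \<longlongrightarrow> F (nat (\<lceil>t * a\<rceil> - 1))) (at_left t)" if "0 < t" for t
  proof (rule tendsto_eventually)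
    have "max 0 ((of_int \<lceil>t * a\<rceil> - 1) / a) < t" using a that by (auto simp: field_simps) linarith
    moreover have "(\<lambda>t\<in>{0..}. F (nat \<lfloor>t * a\<rfloor>)) s = F (nat (\<lceil>t * a\<rceil> - 1))"
      if "max 0 ((of_int \<lceil>t * a\<rceil> - 1) / a) < s" "s < t" for s
    proof -
      have "s * a < t * a" "of_int \<lceil>t * a\<rceil> - 1 < s * a" using that a by (auto simp: field_simps)
      then have "\<lfloor>s * a\<rfloor> = \<lceil>t * a\<rceil> - 1" by linarith
      then show ?thesis using that by simp
    qed
    ultimately show "\<forall>\<^sub>F s in at_left t. (\<lambda>t\<in>{0..}. F (nat \<lfloor>t * a\<rfloor>)) s = F (nat (\<lceil>t * a\<rceil> - 1))"
      unfolding eventually_at_left_field by blast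
  qed
  ultimately show ?thesis by (auto simp: skorohod_paths_def)
qed

section \<open>Counting paths and their jumps\<close>

definition counting_path :: "(real \<Rightarrow> nat) \<Rightarrow> bool" where
  "counting_path x \<longleftrightarrow> mono_on {0..} x \<and>
     (\<forall>t\<ge>0. ((\<lambda>s. real (x s)) \<longlongrightarrow> real (x t)) (at_right t))"

lemma counting_path_mono: "counting_path x \<Longrightarrow> 0 \<le> s \<Longrightarrow> s \<le> t \<Longrightarrow> x s \<le> x t"
  by (auto simp: counting_path_def mono_on_def)

text \<open>Natural numbers at distance below 1 are equal, so right continuity of an integer-valued
  path amounts to local constancy on the right.\<close>

lemma counting_path_right_constant:
  assumes "counting_path x" "0 \<le> t"
  obtains b where "t < b" "\<And>s. t \<le> s \<Longrightarrow> s < b \<Longrightarrow> x s = x t"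
proof -
  have "\<forall>\<^sub>F s in at_right t. dist (real (x s)) (real (x t)) < 1"
    using assms by (intro tendstoD) (auto simp: counting_path_def)
  then obtain b where b: "t < b" "\<And>s. t < s \<Longrightarrow> s < b \<Longrightarrow> dist (real (x s)) (real (x t)) < 1"
    unfolding eventually_at_right_field by blast
  have "x s = x t" if "t \<le> s" "s < b" for s
  proof (cases "s = t")
    case False
    then show ?thesis using b(2)[of s] that by (auto simp: dist_real_def)
  qed simp
  then show ?thesis using that b(1) by blast
qed

lemma counting_path_in_skorohod_paths:
  assumes x: "counting_path x"
  shows "(\<lambda>t\<in>{0..}. real (x t)) \<in> skorohod_paths"
proof -
  have "((\<lambda>t\<in>{0..}. real (x t)) \<longlongrightarrow> real (x t)) (at_right t)" if "0 \<le> t" for t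
  proof -
    have "\<forall>\<^sub>F s in at_right t. real (x s) = (\<lambda>t\<in>{0..}. real (x t)) s"
      unfolding eventually_at_right_field using that by (intro exI[of _ "t + 1"]) auto
    moreover have "((\<lambda>s. real (x s)) \<longlongrightarrow> real (x t)) (at_right t)"
      using x that by (simp add: counting_path_def)
    ultimately show ?thesis by (rule Lim_transform_eventually[rotated])
  qed
  moreover have "\<exists>l. ((\<lambda>t\<in>{0..}. real (x t)) \<longlongrightarrow> l) (at_left t)" if "0 < t" for t
  proof -
    \<comment> \<open>Monotonicity leaves finitely many values before \<open>t\<close>. From a time
      where the largest of them is attained the path is constant up to \<open>t\<close>, which
      yields the left limit.\<close>
    have "x ` {0..<t} \<subseteq> {..x t}" using counting_path_mono[OF x] by auto
    then have fin: "finite (x ` {0..<t})" by (rule finite_subset) simp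
    have "Max (x ` {0..<t}) \<in> x ` {0..<t}" using that by (intro Max_in fin) auto
    then obtain s where s: "0 \<le> s" "s < t" "x s = Max (x ` {0..<t})" by auto
    have "x r = x s" if "s < r" "r < t" for r
    proof (rule antisym)
      show "x r \<le> x s" unfolding s(3) using that s(1) by (intro Max_ge fin) auto
      show "x s \<le> x r" using that s(1) by (intro counting_path_mono[OF x]) auto
    qed
    then have "\<forall>\<^sub>F r in at_left t. (\<lambda>t\<in>{0..}. real (x t)) r = real (x s)"
      unfolding eventually_at_left_field using s by (intro exI[of _ s]) auto
    then show ?thesis using tendsto_eventually by blast
  qed
  ultimately show ?thesis by (auto simp: skorohod_paths_def)
qed

text \<open>A jump is coded as a time whose value exceeds all earlier ones, which captures the
  discontinuities of a counting path without left limits. Keeping \<open>j\<close> strictly inside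
  the interval leaves its end points free to be fixed by time changes.\<close>

definition jump_times :: "(real \<Rightarrow> nat) \<Rightarrow> real \<Rightarrow> real set" where
  "jump_times x m = {j. 0 < j \<and> j < m \<and> (\<forall>s. 0 \<le> s \<and> s < j \<longrightarrow> x s < x j)}"

lemma finite_jump_times:
  assumes x: "counting_path x"
  shows "finite (jump_times x m)"
proof (rule finite_imageD)
  show "finite (x ` jump_times x m)"
    by (rule finite_subset[of _ "{..x m}"])
      (auto simp: jump_times_def intro!: counting_path_mono[OF x])
  show "inj_on x (jump_times x m)"
  proof (rule linorder_inj_onI)
    fix i j assume ij: "i < j" "i \<in> jump_times x m" "j \<in> jump_times x m"
    then have "x i < x j" by (auto simp: jump_times_def)
    then show "x i \<noteq> x j" by simp
  qed auto
qed

text \<open>The jump is the first time at which the path reaches the value \<open>x t\<close>;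
  constancy on the right shows that this infimum is attained.\<close>

lemma jump_time_between:
  assumes x: "counting_path x" and ut: "0 \<le> u" "u \<le> t" "t < m" "x u \<noteq> x t"
  obtains j where "j \<in> jump_times x m" "u < j" "j \<le> t"
proof -
  have lt: "x u < x t" using counting_path_mono[OF x ut(1,2)] ut(4) by simp
  define S where "S = {s. 0 \<le> s \<and> x t \<le> x s}"
  define j where "j = Inf S"
  have bdd: "bdd_below S" by (rule bdd_belowI[of _ 0]) (simp add: S_def)
  have tS: "t \<in> S" using ut by (simp add: S_def)
  have j0: "0 \<le> j" unfolding j_def using tS by (intro cInf_greatest) (auto simp: S_def)
  have jt: "j \<le> t" unfolding j_def using tS bdd by (rule cInf_lower)
  obtain b where b: "j < b" "\<And>s. j \<le> s \<Longrightarrow> s < b \<Longrightarrow> x s = x j"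
    using counting_path_right_constant[OF x j0] by blast
  obtain s where s: "s \<in> S" "s < b"
    using cInf_lessD[of S b] b(1) tS by (auto simp: j_def)
  have "j \<le> s" using s bdd by (simp add: j_def cInf_lower)
  then have xj: "x t \<le> x j" using b(2)[of s] s by (simp add: S_def)
  have uj: "u < j" using counting_path_mono[OF x j0, of u] xj lt by linarith
  have "x s < x j" if "0 \<le> s" "s < j" for s
  proof -
    have "s \<notin> S" using that(2) cInf_lower[OF _ bdd] by (fastforce simp: j_def)
    then show ?thesis using that xj by (simp add: S_def)
  qed
  then have "j \<in> jump_times x m" using uj ut jt by (auto simp: jump_times_def)
  then show ?thesis using that uj jt by blast
qed

text \<open>The threshold \<open>h\<close> is chosen before the targets \<open>c\<close>: the jump
  times stay fixed, while the grid points to which they are moved vary with the mesh.\<close>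

lemma time_change_moving_points:
  fixes m :: real
  assumes J: "finite J" "J \<subseteq> {0<..<m}" and m: "0 < m" and e: "0 < e"
  obtains h where "0 < h"
    "\<And>c. (\<And>j. j \<in> J \<Longrightarrow> \<bar>c j - j\<bar> \<le> h) \<Longrightarrow>
      \<exists>l\<in>time_changes m. (\<forall>j\<in>J. l j = c j) \<and> (\<forall>t\<in>{0..m}. \<bar>l t - t\<bar> \<le> e)"
proof -
  \<comment> \<open>With 0 and \<open>m\<close> among the separated points, every tent centred in
    \<open>J\<close> vanishes at both ends, so the time change fixes them.\<close>
  define D where "D = insert 0 (insert m J)"
  have finD: "finite D" using J by (simp add: D_def)
  define P where "P = insert 1 ((\<lambda>(u, v). \<bar>u - v\<bar>) ` {(u, v). u \<in> D \<and> v \<in> D \<and> u \<noteq> v})"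
  have finP: "finite P"
    unfolding P_def by (intro finite.insertI finite_imageI finite_subset[OF _ finite_cartesian_product[OF finD finD]]) auto
  define d where "d = Min P"
  have d: "0 < d" using finP by (auto simp: d_def Min_gr_iff P_def)
  have dle: "d \<le> \<bar>u - v\<bar>" if "u \<in> D" "v \<in> D" "u \<noteq> v" for u v
    unfolding d_def using that by (intro Min_le finP) (auto simp: P_def)
  \<comment> \<open>The time change is the identity plus multiples of these tents, each of which vanishes at
    all points of \<open>D\<close> except its own centre.\<close>
  define T where "T j t = max 0 (1 - \<bar>t - j\<bar> / d)" for j t :: real
  have T1: "T j j = 1" for j by (simp add: T_def)
  have T0: "T j t = 0" if "j \<in> D" "t \<in> D" "j \<noteq> t" for j t
    using dle[OF that(2,1)] that d by (auto simp: T_def max_def field_simps)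
  have Tb: "\<bar>T j t\<bar> \<le> 1" for j t using d by (auto simp: T_def)
  have Tlip: "\<bar>T j t - T j s\<bar> \<le> \<bar>t - s\<bar> / d" for j s t
  proof -
    have "\<bar>\<bar>t - j\<bar> / d - \<bar>s - j\<bar> / d\<bar> = \<bar>\<bar>t - j\<bar> - \<bar>s - j\<bar>\<bar> / d"
      using d by (simp add: abs_divide flip: diff_divide_distrib)
    also have "\<dots> \<le> \<bar>t - s\<bar> / d" using d by (intro divide_right_mono) auto
    finally show ?thesis unfolding T_def by linarith
  qed
  define n where "n = real (card J) + 1"
  have n: "0 < n" by (simp add: n_def)
  \<comment> \<open>Each scaled tent has height at most \<open>h\<close> and slope at most
    \<open>h / d\<close>. As \<open>card J * h\<close> is at most \<open>e\<close> and below
    \<open>d\<close>, their sum stays within \<open>e\<close> and has slope below 1, so the identity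
    plus this sum remains strictly increasing. The summand 1 in \<open>n\<close> covers an empty
    \<open>J\<close>.\<close>
  define h where "h = min e (d / 2) / n"
  have h: "0 < h" using n e d by (simp add: h_def)
  have he: "real (card J) * h \<le> e" "real (card J) * h < d"
  proof -
    have "real (card J) * h < n * h" using h by (simp add: n_def)
    also have "n * h = min e (d / 2)" using n by (simp add: h_def)
    finally show "real (card J) * h \<le> e" "real (card J) * h < d" using d by auto
  qed
  show ?thesis
  proof (rule that[OF h])
    fix c assume c: "\<And>j. j \<in> J \<Longrightarrow> \<bar>c j - j\<bar> \<le> h"
    define l where "l t = t + (\<Sum>j\<in>J. (c j - j) * T j t)" for t
    have sm: "l s < l t" if "s < t" for s t
    proof -
      have "\<bar>(\<Sum>j\<in>J. (c j - j) * (T j t - T j s))\<bar> \<le> (\<Sum>j\<in>J. h * (\<bar>t - s\<bar> / d))"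
        by (intro order_trans[OF sum_abs] sum_mono)
          (unfold abs_mult, intro mult_mono c Tlip, use h in auto)
      also have "\<dots> = (real (card J) * h) * ((t - s) / d)" using that by simp
      also have "\<dots> < d * ((t - s) / d)" using he(2) d that by (intro mult_strict_right_mono) auto
      also have "\<dots> = t - s" using d by simp
      finally have "\<bar>(\<Sum>j\<in>J. (c j - j) * (T j t - T j s))\<bar> < t - s" .
      then show ?thesis by (simp add: l_def right_diff_distrib sum_subtractf)
    qed
    have close: "\<bar>l t - t\<bar> \<le> e" for t
    proof -
      have "\<bar>\<Sum>j\<in>J. (c j - j) * T j t\<bar> \<le> (\<Sum>j\<in>J. h * 1)"
        by (intro order_trans[OF sum_abs] sum_mono)
          (unfold abs_mult, intro mult_mono c Tb, use h in auto)
      then show ?thesis using he(1) by (simp add: l_def)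
    qed
    have cont: "continuous_on A l" for A
      unfolding l_def T_def by (intro continuous_intros) (use d in auto)
    have l0: "l 0 = 0"
      unfolding l_def using J(2) by (auto intro!: sum.neutral simp: D_def T0)
    have lm: "l m = m"
      unfolding l_def using J(2) by (auto intro!: sum.neutral simp: D_def T0)
    have lj: "l j = c j" if "j \<in> J" for j
    proof -
      have "(\<Sum>i\<in>J. (c i - i) * T i j) = (\<Sum>i\<in>J. if i = j then c j - j else 0)"
        using that by (intro sum.cong) (auto simp: T1 T0 D_def)
      then show ?thesis using that J(1) by (simp add: l_def)
    qed
    have "l ` {0..m} = {0..m}"
    proof
      show "l ` {0..m} \<subseteq> {0..m}"
      proof safe
        fix t assume t: "t \<in> {0..m}"
        then show "l t \<in> {0..m}" using sm[of 0 t] sm[of t m] l0 lm by fastforce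
      qed
      show "{0..m} \<subseteq> l ` {0..m}"
      proof
        fix y assume "y \<in> {0..m}"
        then show "y \<in> l ` {0..m}"
          using IVT'[of l 0 y m] l0 lm m cont by force
      qed
    qed
    then have "l \<in> time_changes m"
      using cont sm by (auto simp: time_changes_def strict_mono_on_def)
    then show "\<exists>l\<in>time_changes m. (\<forall>j\<in>J. l j = c j) \<and> (\<forall>t\<in>{0..m}. \<bar>l t - t\<bar> \<le> e)"
      using lj close by blast
  qed
qed

text \<open>Freezing the index at \<open>L\<close> makes the path a function of the finitely many
  values at i / a with i at most \<open>L\<close>, at the price of losing track of \<open>x\<close>
  past time L / a.\<close>

definition sampled :: "real \<Rightarrow> nat \<Rightarrow> (real \<Rightarrow> nat) \<Rightarrow> real \<Rightarrow> nat" where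
  "sampled a L x t = x (real (min (nat \<lfloor>t * a\<rfloor>) L) / a)"

text \<open>The sampled path notices a jump \<open>j\<close> at the first grid time not before
  \<open>j\<close>. A time change that sends every jump there turns the sampled path into
  \<open>x\<close> exactly, so the error comes only from the displacement of time and from the
  taper.\<close>

lemma skorohod_dist_upto_sampled:
  assumes x: "counting_path x" and m: "0 < m" and e: "0 < e"
  obtains A where "0 < A"
    "\<And>a L. A \<le> a \<Longrightarrow> m \<le> real L / a \<Longrightarrow>
      skorohod_dist_upto m (taper m (\<lambda>t\<in>{0..}. real (x t)))
        (taper m (\<lambda>t\<in>{0..}. real (sampled a L x t))) \<le> e"
proof -
  define J where "J = jump_times x m"
  \<comment> \<open>The taper factors differ by at most \<open>e'\<close> and multiply values up to
    \<open>x m\<close>; this \<open>e'\<close> keeps the product below \<open>e\<close>.\<close>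
  define e' where "e' = e / (real (x m) + 1)"
  have e': "0 < e'" "e' \<le> e" "e' * real (x m) \<le> e" using e by (auto simp: e'_def field_simps)
  obtain h where h: "0 < h"
    and tc: "\<And>c. (\<And>j. j \<in> J \<Longrightarrow> \<bar>c j - j\<bar> \<le> h) \<Longrightarrow>
      \<exists>l\<in>time_changes m. (\<forall>j\<in>J. l j = c j) \<and> (\<forall>t\<in>{0..m}. \<bar>l t - t\<bar> \<le> e')"
  proof (rule time_change_moving_points[OF _ _ m e'(1), of J])
    show "finite J" unfolding J_def by (rule finite_jump_times[OF x])
    show "J \<subseteq> {0<..<m}" by (auto simp: J_def jump_times_def)
  qed (use that in blast)
  show ?thesis
  proof (rule that[of "1 / h"])
    show "0 < 1 / h" using h by simp
    fix a L assume a: "1 / h \<le> a" and L: "m \<le> real L / a"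
    have a0: "0 < a" using a h by (meson less_le_trans zero_less_divide_1_iff)
    have ah: "1 / a \<le> h" using a a0 h by (simp add: field_simps)
    have "\<bar>of_int \<lceil>j * a\<rceil> / a - j\<bar> \<le> h" for j
    proof -
      have "\<bar>of_int \<lceil>j * a\<rceil> - j * a\<bar> \<le> 1" by linarith
      then have "\<bar>of_int \<lceil>j * a\<rceil> - j * a\<bar> / a \<le> 1 / a" using a0 by (intro divide_right_mono) auto
      then have "\<bar>(of_int \<lceil>j * a\<rceil> - j * a) / a\<bar> \<le> h" using a0 ah by (simp add: abs_divide)
      moreover have "(of_int \<lceil>j * a\<rceil> - j * a) / a = of_int \<lceil>j * a\<rceil> / a - j"
        using a0 by (simp add: diff_divide_distrib)
      ultimately show ?thesis by simp
    qed
    then obtain l where l: "l \<in> time_changes m" "\<And>j. j \<in> J \<Longrightarrow> l j = of_int \<lceil>j * a\<rceil> / a"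
      and lc: "\<And>t. t \<in> {0..m} \<Longrightarrow> \<bar>l t - t\<bar> \<le> e'"
      using tc[of "\<lambda>j. of_int \<lceil>j * a\<rceil> / a"] by blast
    have lin: "l t \<in> {0..m}" if "t \<in> {0..m}" for t using l(1) that by (auto simp: time_changes_def)
    have lmono: "l s < l t \<longleftrightarrow> s < t" "l s \<le> l t \<longleftrightarrow> s \<le> t" if "s \<in> {0..m}" "t \<in> {0..m}" for s t
      using l(1) that by (auto simp: time_changes_def strict_mono_on_less strict_mono_on_less_eq)
    have lm: "l m = m"
    proof -
      obtain s where s: "s \<in> {0..m}" "l s = m"
        using l(1) m unfolding time_changes_def by (metis (mono_tags, lifting) mem_Collect_eq atLeastAtMost_iff imageE order.refl less_imp_le)
      have "m \<le> l m" using lmono(2)[of s m] s m by simp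
      then show ?thesis using lin[of m] m by simp
    qed
    have key: "sampled a L x (l t) = x t" if t: "0 \<le> t" "t < m" for t
    proof -
      define u where "u = real_of_int \<lfloor>l t * a\<rfloor> / a"
      have lt: "0 \<le> l t" "l t < m" using lin[of t] lmono(1)[of t m] t lm m by auto
      have u: "0 \<le> u" "u \<le> l t" using lt a0 by (auto simp: u_def field_simps)
      have "l t * a < real L"
      proof -
        have "l t * a < m * a" using lt a0 by simp
        also have "m * a \<le> real L" using L a0 by (simp add: field_simps)
        finally show ?thesis .
      qed
      then have "nat \<lfloor>l t * a\<rfloor> \<le> L" using lt a0 by linarith
      then have su: "sampled a L x (l t) = x u"
        using lt a0 by (simp add: sampled_def u_def min_def)
      \<comment> \<open>The grid time \<open>u\<close> seen by the sampled path at
        \<open>l t\<close> lies beyond the same jumps as \<open>t\<close>. A difference between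
        \<open>x u\<close> and \<open>x t\<close> would produce a jump between \<open>u\<close> and
        \<open>t\<close>.\<close>
      have iff: "j \<le> u \<longleftrightarrow> j \<le> t" if j: "j \<in> J" for j
      proof -
        have "j \<le> u \<longleftrightarrow> j * a \<le> of_int \<lfloor>l t * a\<rfloor>" using a0 by (simp add: u_def field_simps)
        also have "\<dots> \<longleftrightarrow> of_int \<lceil>j * a\<rceil> \<le> l t * a" by (metis ceiling_le_iff le_floor_iff)
        also have "\<dots> \<longleftrightarrow> l j \<le> l t" using a0 l(2)[OF j] by (simp add: pos_divide_le_eq)
        also have "\<dots> \<longleftrightarrow> j \<le> t" using j t by (intro lmono) (auto simp: J_def jump_times_def)
        finally show ?thesis .
      qed
      have "x u = x t"
      proof (rule ccontr)
        assume neq: "x u \<noteq> x t"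
        show False
        proof (cases "u \<le> t")
          case True
          then obtain j where "j \<in> J" "u < j" "j \<le> t"
            using jump_time_between[OF x u(1) True t(2) neq] by (auto simp: J_def)
          then show False using iff by force
        next
          case False
          then have "t \<le> u" "u < m" using u lt by auto
          then obtain j where "j \<in> J" "t < j" "j \<le> u"
            using jump_time_between[OF x t(1), of u m] neq by (auto simp: J_def)
          then show False using iff by force
        qed
      qed
      then show ?thesis using su by simp
    qed
    show "skorohod_dist_upto m (taper m (\<lambda>t\<in>{0..}. real (x t)))
        (taper m (\<lambda>t\<in>{0..}. real (sampled a L x t))) \<le> e"
    proof (rule skorohod_dist_upto_le[OF l(1) e], rule conjI)
      fix t assume t: "t \<in> {0..m}"
      show "\<bar>l t - t\<bar> \<le> e" using lc[OF t] e'(2) by simp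
      show "\<bar>taper m (\<lambda>t\<in>{0..}. real (x t)) t
          - taper m (\<lambda>t\<in>{0..}. real (sampled a L x t)) (l t)\<bar> \<le> e"
      proof (cases "t < m")
        case True
        define p where "p s = max 0 (min 1 (m - s))" for s
        have "\<bar>p t - p (l t)\<bar> \<le> \<bar>l t - t\<bar>" unfolding p_def by linarith
        then have p: "\<bar>p t - p (l t)\<bar> \<le> e'" using lc[OF t] by linarith
        have "taper m (\<lambda>t\<in>{0..}. real (x t)) t
          - taper m (\<lambda>t\<in>{0..}. real (sampled a L x t)) (l t) = (p t - p (l t)) * real (x t)"
          using t True lin[OF t] key[of t] by (simp add: taper_def p_def left_diff_distrib)
        also have "\<bar>\<dots>\<bar> \<le> e' * real (x m)"
          unfolding abs_mult using p t counting_path_mono[OF x, of t m] e'(1)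
          by (intro mult_mono) auto
        also have "\<dots> \<le> e" by (rule e'(3))
        finally show ?thesis .
      next
        case False
        then have "t = m" using t by simp
        then show ?thesis using lm e by (simp add: taper_def)
      qed
    qed
  qed
qed

text \<open>Each term of the series tends to 0, and Tannery's theorem applies with the geometric
  weights as majorant.\<close>

lemma tendsto_skorohod_dist_sampled:
  assumes x: "counting_path x"
    and a: "filterlim a at_top sequentially"
    and L: "filterlim (\<lambda>n. real (L n) / a n) at_top sequentially"
  shows "(\<lambda>n. skorohod_dist (\<lambda>t\<in>{0..}. real (x t)) (\<lambda>t\<in>{0..}. real (sampled (a n) (L n) x t))) \<longlonglongrightarrow> 0"
proof -
  let ?D = "\<lambda>n k. (1/2) ^ Suc k * skorohod_dist_upto (real (Suc k))
     (taper (real (Suc k)) (\<lambda>t\<in>{0..}. real (x t)))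
     (taper (real (Suc k)) (\<lambda>t\<in>{0..}. real (sampled (a n) (L n) x t)))"
  have lim: "(\<lambda>n. ?D n k) \<longlonglongrightarrow> (1/2) ^ Suc k * 0" for k
  proof (rule tendsto_mult_left, rule tendstoI)
    fix e :: real assume "0 < e"
    then have e: "0 < e / 2" by simp
    obtain A where A: "\<And>a L. A \<le> a \<Longrightarrow> real (Suc k) \<le> real L / a \<Longrightarrow>
      skorohod_dist_upto (real (Suc k)) (taper (real (Suc k)) (\<lambda>t\<in>{0..}. real (x t)))
        (taper (real (Suc k)) (\<lambda>t\<in>{0..}. real (sampled a L x t))) \<le> e / 2"
      using skorohod_dist_upto_sampled[OF x _ e, of "real (Suc k)"] by (metis of_nat_0_less_iff zero_less_Suc)
    have "\<forall>\<^sub>F n in sequentially. A \<le> a n" "\<forall>\<^sub>F n in sequentially. real (Suc k) \<le> real (L n) / a n"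
      using a L by (auto simp: filterlim_at_top)
    then show "\<forall>\<^sub>F n in sequentially. dist (skorohod_dist_upto (real (Suc k))
     (taper (real (Suc k)) (\<lambda>t\<in>{0..}. real (x t)))
     (taper (real (Suc k)) (\<lambda>t\<in>{0..}. real (sampled (a n) (L n) x t)))) 0 < e"
    proof eventually_elim
      case (elim n)
      then show ?case
        using A[OF elim] skorohod_dist_upto_nonneg e
        by (simp add: dist_real_def del: of_nat_Suc)
    qed
  qed
  have sg: "summable (\<lambda>k. (1/2::real) ^ Suc k)"
    using summable_mult[OF summable_geometric[of "1/2::real"], of "1/2"] by simp
  have "(\<lambda>n. \<Sum>k. ?D n k) \<longlonglongrightarrow> (\<Sum>k. (1/2) ^ Suc k * 0)"
  proof (rule tannerys_theorem[where F = sequentially and M = "\<lambda>k. (1/2) ^ Suc k", THEN conjunct2, THEN conjunct2])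
    show "(\<lambda>n. ?D n k) \<longlonglongrightarrow> (1/2) ^ Suc k * 0" for k by (rule lim)
    show "\<forall>\<^sub>F (k, n) in at_top \<times>\<^sub>F sequentially. norm (?D n k) \<le> (1/2) ^ Suc k"
      by (intro always_eventually)
        (auto simp: abs_mult skorohod_dist_upto_nonneg skorohod_dist_upto_le1 mult_left_le)
  qed (use sg in auto)
  then show ?thesis by (simp add: skorohod_dist_def)
qed

text \<open>The first \<open>K\<close> terms look only at times up to \<open>K\<close> and vanish
  under the identity time change; the weights of the remaining terms add up to (1/2)^K.\<close>

lemma skorohod_dist_le_if_eq_upto:
  assumes eq: "\<And>t. 0 \<le> t \<Longrightarrow> t \<le> real K \<Longrightarrow> x t = y t"
  shows "skorohod_dist x y \<le> (1/2) ^ K"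
proof -
  let ?D = "\<lambda>k. (1/2) ^ Suc k * skorohod_dist_upto (real (Suc k))
     (taper (real (Suc k)) x) (taper (real (Suc k)) y)"
  have z: "?D k = 0" if "k < K" for k
  proof -
    have "skorohod_dist_upto (real (Suc k)) (taper (real (Suc k)) x) (taper (real (Suc k)) y) \<le> e"
      if "0 < e" for e
      using that \<open>k < K\<close>
      by (intro skorohod_dist_upto_le[of "\<lambda>t. t"])
        (auto simp: time_changes_def strict_mono_on_def taper_def eq)
    then have "skorohod_dist_upto (real (Suc k)) (taper (real (Suc k)) x) (taper (real (Suc k)) y) \<le> 0"
      by (rule dense_ge)
    then show ?thesis using skorohod_dist_upto_nonneg[of "real (Suc k)"] by (metis antisym mult_zero_right)
  qed
  have sg: "(\<lambda>k. (1/2::real) ^ Suc (k + K)) sums (1/2) ^ K"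
  proof -
    have "(\<lambda>k. ((1/2) ^ K / 2) * (1/2::real) ^ k) sums (((1/2) ^ K / 2) * (1 / (1 - 1/2)))"
      by (intro sums_mult geometric_sums) simp
    then show ?thesis by (simp add: power_add mult_ac)
  qed
  have "skorohod_dist x y = (\<Sum>k. ?D (k + K)) + (\<Sum>k<K. ?D k)"
    unfolding skorohod_dist_def by (rule suminf_split_initial_segment[OF summable_skorohod_dist])
  also have "(\<Sum>k<K. ?D k) = 0" using z by (intro sum.neutral) auto
  also have "(\<Sum>k. ?D (k + K)) \<le> (\<Sum>k. (1/2) ^ Suc (k + K))"
    by (intro suminf_le summable_ignore_initial_segment[OF summable_skorohod_dist]
        sums_summable[OF sg] mult_left_le skorohod_dist_upto_le1) simp
  finally show ?thesis using sums_unique[OF sg] by simp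
qed

section \<open>Measurability\<close>

interpretation Skorohod: Metric_space skorohod_paths skorohod_dist
  by (rule Metric_space_skorohod)

text \<open>The limit lies in an open \<open>U\<close> exactly when, for some \<open>k\<close>,
  almost all approximants have their ball of radius 1 / (k + 1) inside \<open>U\<close>. The
  approximants behave like discrete variables, in that preimages of all sets are measurable, so this
  describes the event by countable operations.\<close>

lemma (in Metric_space) measurable_borel_of_limit:
  assumes X: "\<And>\<omega>. \<omega> \<in> space P \<Longrightarrow> X \<omega> \<in> M"
    and Z: "\<And>n \<omega>. \<omega> \<in> space P \<Longrightarrow> Z n \<omega> \<in> M"
    and Zm: "\<And>n A. Z n -` A \<inter> space P \<in> sets P"
    and lim: "\<And>\<omega>. \<omega> \<in> space P \<Longrightarrow> (\<lambda>n. d (X \<omega>) (Z n \<omega>)) \<longlonglongrightarrow> 0"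
  shows "X \<in> P \<rightarrow>\<^sub>M borel_of mtopology"
  unfolding borel_of_def topspace_mtopology
proof (rule measurable_measure_of)
  show "{U. openin mtopology U} \<subseteq> Pow M" by (auto simp: openin_mtopology)
  show "X \<in> space P \<rightarrow> M" using X by auto
  fix U assume "U \<in> {U. openin mtopology U}"
  then have U: "\<And>x. x \<in> U \<Longrightarrow> \<exists>r>0. mball x r \<subseteq> U" by (auto simp: openin_mtopology)
  define F where "F k = {x \<in> M. mball x (1 / real (Suc k)) \<subseteq> U}" for k
  have "X -` U \<inter> space P = (\<Union>k. \<Union>m. \<Inter>n\<in>{m..}. Z n -` F k \<inter> space P)"
  proof (intro equalityI subsetI)
    fix \<omega> assume "\<omega> \<in> X -` U \<inter> space P"
    then have \<omega>: "X \<omega> \<in> U" "\<omega> \<in> space P" by auto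
    then obtain r where r: "0 < r" "mball (X \<omega>) r \<subseteq> U" using U by blast
    obtain k where k: "1 / real (Suc k) < r / 2"
      using nat_approx_posE[of "r / 2"] r(1) by auto
    have "\<forall>\<^sub>F n in sequentially. d (X \<omega>) (Z n \<omega>) < r / 2"
      using order_tendstoD(2)[OF lim[OF \<omega>(2)], of "r / 2"] r(1) by simp
    then obtain m where m: "\<And>n. m \<le> n \<Longrightarrow> d (X \<omega>) (Z n \<omega>) < r / 2"
      unfolding eventually_sequentially by blast
    have "Z n \<omega> \<in> F k" if "m \<le> n" for n
    proof -
      have "mball (Z n \<omega>) (1 / real (Suc k)) \<subseteq> mball (X \<omega>) r"
        using m[OF that] k X[OF \<omega>(2)] commute[of "X \<omega>" "Z n \<omega>"] by (intro mball_subset) auto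
      then show ?thesis using r(2) Z[OF \<omega>(2)] by (auto simp: F_def)
    qed
    then show "\<omega> \<in> (\<Union>k. \<Union>m. \<Inter>n\<in>{m..}. Z n -` F k \<inter> space P)" using \<omega> by auto
  next
    fix \<omega> assume "\<omega> \<in> (\<Union>k. \<Union>m. \<Inter>n\<in>{m..}. Z n -` F k \<inter> space P)"
    then obtain k m where km: "\<And>n. m \<le> n \<Longrightarrow> Z n \<omega> \<in> F k" and \<omega>: "\<omega> \<in> space P" by auto
    have "\<forall>\<^sub>F n in sequentially. d (X \<omega>) (Z n \<omega>) < 1 / real (Suc k)"
      using order_tendstoD(2)[OF lim[OF \<omega>], of "1 / real (Suc k)"] by simp
    then obtain n where "m \<le> n" "d (X \<omega>) (Z n \<omega>) < 1 / real (Suc k)"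
      unfolding eventually_sequentially by (metis linear)
    then have "X \<omega> \<in> mball (Z n \<omega>) (1 / real (Suc k))" "mball (Z n \<omega>) (1 / real (Suc k)) \<subseteq> U"
      using X[OF \<omega>] Z[OF \<omega>] km commute by (auto simp: F_def)
    then show "\<omega> \<in> X -` U \<inter> space P" using \<omega> by blast
  qed
  moreover have "(\<Union>k. \<Union>m. \<Inter>n\<in>{m..}. Z n -` F k \<inter> space P) \<in> sets P"
  proof -
    have "(\<Inter>n\<in>{m..}. Z n -` F k \<inter> space P) \<in> sets P" for k m
      using Zm by (intro sets.countable_INT') auto
    then show ?thesis by (intro sets.countable_nat_UN image_subsetI)
  qed
  ultimately show "X -` U \<inter> space P \<in> sets P" by (simp only:)
qed

lemma space_borel_of [simp]: "space (borel_of T) = topspace T"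
  unfolding borel_of_def by (rule space_measure_of_conv)

lemma borel_measurable_continuous_map:
  assumes "continuous_map T euclideanreal f"
  shows "f \<in> borel_measurable (borel_of T)"
proof (rule borel_measurableI)
  fix S :: "real set" assume "open S"
  then have "openin T {x \<in> topspace T. f x \<in> S}"
    using assms by (simp add: openin_continuous_map_preimage)
  moreover have "sets (borel_of T) = sigma_sets (topspace T) {U. openin T U}"
    unfolding borel_of_def by (rule sets_measure_of) (auto dest: openin_subset)
  moreover have "f -` S \<inter> space (borel_of T) = {x \<in> topspace T. f x \<in> S}" by auto
  ultimately show "f -` S \<inter> space (borel_of T) \<in> sets (borel_of T)" by simp
qed

text \<open>The sampled path is a function \<open>G\<close> of the list \<open>V\<close> of sampled
  values, and lists of naturals form a countable type. Hence arbitrary sets of paths, not only Borel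
  sets, have measurable preimages.\<close>

lemma sampled_vimage_measurable:
  assumes Y: "\<And>t. 0 \<le> t \<Longrightarrow> Y t \<in> M \<rightarrow>\<^sub>M count_space UNIV" and a: "0 \<le> a"
  shows "(\<lambda>\<omega>. \<lambda>t\<in>{0..}. real (sampled a L (\<lambda>t. Y t \<omega>) t)) -` A \<inter> space M \<in> sets M"
proof -
  define V where "V \<omega> = map (\<lambda>i. Y (real i / a) \<omega>) [0..<Suc L]" for \<omega>
  define G where "G xs = (\<lambda>t\<in>{0..}. real (xs ! min (nat \<lfloor>t * a\<rfloor>) L))" for xs :: "nat list"
  have V: "length (V \<omega>) = Suc L" "\<And>i. i \<le> L \<Longrightarrow> V \<omega> ! i = Y (real i / a) \<omega>" for \<omega>
    by (simp_all add: V_def del: upt_Suc)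
  have "V \<in> M \<rightarrow>\<^sub>M count_space UNIV"
  proof (subst measurable_count_space_eq2_countable, intro conjI ballI)
    fix xs :: "nat list"
    show "V -` {xs} \<inter> space M \<in> sets M"
    proof (cases "length xs = Suc L")
      case True
      have "V \<omega> = xs \<longleftrightarrow> (\<forall>i\<in>{..L}. Y (real i / a) \<omega> = xs ! i)" for \<omega>
        using True by (simp add: list_eq_iff_nth_eq V less_Suc_eq_le Ball_def)
      then have "V -` {xs} \<inter> space M = {\<omega> \<in> space M. \<forall>i\<in>{..L}. Y (real i / a) \<omega> = xs ! i}" by blast
      also have "\<dots> \<in> sets M"
      proof (rule sets.sets_Collect_finite_All)
        fix i
        have "Y (real i / a) -` {xs ! i} \<inter> space M \<in> sets M"
          using a by (intro measurable_sets[OF Y]) auto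
        moreover have "Y (real i / a) -` {xs ! i} \<inter> space M = {\<omega> \<in> space M. Y (real i / a) \<omega> = xs ! i}" by blast
        ultimately show "{\<omega> \<in> space M. Y (real i / a) \<omega> = xs ! i} \<in> sets M" by (simp only:)
      qed simp
      finally show ?thesis .
    next
      case False
      then have "V -` {xs} \<inter> space M = {}" using V(1) by blast
      then show ?thesis by (simp only: sets.empty_sets)
    qed
  qed auto
  then have "V -` (G -` A) \<inter> space M \<in> sets M" by (rule measurable_sets) simp
  moreover have "(\<lambda>t\<in>{0..}. real (sampled a L (\<lambda>t. Y t \<omega>) t)) = G (V \<omega>)" for \<omega>
    by (simp add: G_def V sampled_def)
  ultimately show ?thesis by (simp add: vimage_def)
qed

lemma sampled_in_skorohod_paths:
  "0 \<le> a \<Longrightarrow> (\<lambda>t\<in>{0..}. real (sampled a L x t)) \<in> skorohod_paths"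
  unfolding sampled_def by (rule step_path_in_skorohod_paths[where F = "\<lambda>i. real (x (real (min i L) / a))"])

section \<open>Edge patterns of the growing random graph\<close>

definition occupied_vertices :: "item list \<Rightarrow> nat set" where
  "occupied_vertices h = {v. Vertex v \<in> set h}"

definition occupied_edges :: "item list \<Rightarrow> nat set set" where
  "occupied_edges h = {e. Edge e \<in> set h}"

definition possible_edges :: "item list \<Rightarrow> nat set set" where
  "possible_edges h = {e. e \<subseteq> occupied_vertices h \<and> card e = 2}"

text \<open>The invariant under which item counts are cardinalities and the pool splits into N - n
  vertices and (n choose 2) - k edges.\<close>

definition valid_history :: "nat \<Rightarrow> item list \<Rightarrow> bool" where
  "valid_history N h \<longleftrightarrow> distinct h \<and> occupied_vertices h \<subseteq> {..<N} \<and>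
     occupied_edges h \<subseteq> possible_edges h"

lemma vertex_count_eq_card: "distinct h \<Longrightarrow> vertex_count h = card (occupied_vertices h)"
proof -
  assume "distinct h"
  then have "vertex_count h = card (set (filter (\<lambda>x. \<exists>v. x = Vertex v) h))"
    unfolding vertex_count_def by (metis distinct_card distinct_filter)
  also have "set (filter (\<lambda>x. \<exists>v. x = Vertex v) h) = Vertex ` occupied_vertices h"
    by (auto simp: occupied_vertices_def)
  finally show ?thesis by (simp add: card_image inj_on_def)
qed

lemma edge_count_eq_card: "distinct h \<Longrightarrow> edge_count h = card (occupied_edges h)"
proof -
  assume "distinct h"
  then have "edge_count h = card (set (filter (\<lambda>x. \<exists>e. x = Edge e) h))"
    unfolding edge_count_def by (metis distinct_card distinct_filter)
  also have "set (filter (\<lambda>x. \<exists>e. x = Edge e) h) = Edge ` occupied_edges h"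
    by (auto simp: occupied_edges_def)
  finally show ?thesis by (simp add: card_image inj_on_def)
qed

lemma finite_occupied_vertices: "finite (occupied_vertices h)"
  unfolding occupied_vertices_def
  by (rule finite_subset[OF _ finite_imageI[of "set h" "\<lambda>x. case x of Vertex v \<Rightarrow> v | Edge e \<Rightarrow> 0"]])
    (force simp: image_iff)+

lemma finite_possible_edges: "finite (possible_edges h)"
  by (rule finite_subset[of _ "Pow (occupied_vertices h)"])
    (auto simp: possible_edges_def finite_occupied_vertices)

lemma card_possible_edges:
  "distinct h \<Longrightarrow> card (possible_edges h) = vertex_count h choose 2"
  by (simp add: possible_edges_def n_subsets finite_occupied_vertices vertex_count_eq_card)

lemma pool_eq:
  "pool N h = Vertex ` ({..<N} - occupied_vertices h) \<union> Edge ` (possible_edges h - occupied_edges h)"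
proof -
  have "{Edge {u, v} | u v. u \<noteq> v \<and> Vertex u \<in> set h \<and> Vertex v \<in> set h} = Edge ` possible_edges h"
    by (auto simp: possible_edges_def occupied_vertices_def card_2_iff image_iff)
  then show ?thesis
    unfolding pool_def by (auto simp: occupied_vertices_def occupied_edges_def)
qed

context
  fixes N h assumes valid: "valid_history N h"
begin

lemma card_free_vertices: "card (Vertex ` ({..<N} - occupied_vertices h)) = N - vertex_count h"
  using valid by (simp add: valid_history_def card_image inj_on_def card_Diff_subset
      finite_occupied_vertices vertex_count_eq_card)

lemma card_free_edges:
  "card (Edge ` (possible_edges h - occupied_edges h)) = (vertex_count h choose 2) - edge_count h"
  using valid finite_subset[OF _ finite_possible_edges, of "occupied_edges h" h]
  by (simp add: valid_history_def card_image inj_on_def card_Diff_subset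
      edge_count_eq_card flip: card_possible_edges)

lemma edge_count_le: "edge_count h \<le> vertex_count h choose 2"
  using valid card_mono[OF finite_possible_edges, of "occupied_edges h" h]
  by (simp add: valid_history_def edge_count_eq_card card_possible_edges)

lemma finite_pool: "finite (pool N h)"
  by (simp add: pool_eq finite_possible_edges)

lemma card_pool:
  "real (card (pool N h)) =
    real (N - vertex_count h) + (real (vertex_count h choose 2) - real (edge_count h))"
proof -
  have "card (pool N h) = card (Vertex ` ({..<N} - occupied_vertices h)) +
      card (Edge ` (possible_edges h - occupied_edges h))"
    unfolding pool_eq by (intro card_Un_disjoint) (auto simp: finite_possible_edges)
  then show ?thesis
    using edge_count_le by (simp add: card_free_vertices card_free_edges of_nat_diff)
qed

lemma valid_history_snoc:
  assumes "x \<in> pool N h"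
  shows "valid_history N (h @ [x])"
  using assms valid
  by (auto simp: valid_history_def pool_eq occupied_vertices_def occupied_edges_def possible_edges_def)

end

section \<open>Counts along a growing run\<close>

lemma vertex_count_append: "vertex_count (g @ h) = vertex_count g + vertex_count h"
  by (simp add: vertex_count_def)

lemma edge_count_append: "edge_count (g @ h) = edge_count g + edge_count h"
  by (simp add: edge_count_def)

lemma count_singleton [simp]:
  "vertex_count [Vertex v] = 1" "vertex_count [Edge e] = 0"
  "edge_count [Vertex v] = 0" "edge_count [Edge e] = 1"
  by (auto simp: vertex_count_def edge_count_def)

lemma vertex_count_take_le: "vertex_count (take m h) \<le> vertex_count h"
  by (metis append_take_drop_id le_add1 vertex_count_append)

text \<open>Once \<open>i\<close> vertices are occupied, the \<open>i\<close>-th occupation time is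
  decided by the prefix. The bound by \<open>length h\<close> lets the edge count at that time be
  read off from the prefix as well.\<close>

lemma occupation_time_append:
  assumes "i \<le> vertex_count h"
  shows "occupation_time i (h @ r) = occupation_time i h" "occupation_time i h \<le> length h"
proof -
  define m where "m = occupation_time i h"
  have m: "i \<le> vertex_count (take m h)"
    unfolding m_def occupation_time_def by (rule LeastI_ex, rule exI[of _ "length h"]) (use assms in simp)
  have ml: "m \<le> y" if "i \<le> vertex_count (take y h)" for y
    unfolding m_def occupation_time_def by (rule Least_le) (rule that)
  show le: "occupation_time i h \<le> length h"
    using ml[of "length h"] assms by (simp add: m_def)
  have "occupation_time i (h @ r) = m"
    unfolding occupation_time_def
  proof (rule Least_equality)
    show "i \<le> vertex_count (take m (h @ r))" using m le by (simp add: m_def)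
    fix y assume y: "i \<le> vertex_count (take y (h @ r))"
    show "m \<le> y"
    proof (cases "y \<le> length h")
      case True
      then show ?thesis using ml y by simp
    qed (use le in \<open>simp add: m_def\<close>)
  qed
  then show "occupation_time i (h @ r) = occupation_time i h" by (simp add: m_def)
qed

lemma edges_at_append:
  "i \<le> N \<Longrightarrow> i \<le> vertex_count h \<Longrightarrow> edges_at N i (h @ r) = edges_at N i h"
  using occupation_time_append(1)[of i h r] occupation_time_append(2)[of i h] by (simp add: edges_at_def)

lemma edges_at_snoc:
  assumes "vertex_count g = i" "i < N"
  shows "edges_at N (Suc i) (g @ [Vertex v]) = edge_count g"
proof -
  have "occupation_time (Suc i) (g @ [Vertex v]) = Suc (length g)"
    unfolding occupation_time_def
  proof (rule Least_equality)
    show "Suc i \<le> vertex_count (take (Suc (length g)) (g @ [Vertex v]))"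
      using assms by (simp add: vertex_count_append)
    fix y assume y: "Suc i \<le> vertex_count (take y (g @ [Vertex v]))"
    show "Suc (length g) \<le> y"
    proof (rule ccontr)
      assume "\<not> Suc (length g) \<le> y"
      then have "take y (g @ [Vertex v]) = take y g" by simp
      then show False using y assms vertex_count_take_le[of y g] by simp
    qed
  qed
  then show ?thesis using assms by (simp add: edges_at_def edge_count_append)
qed

section \<open>First-step analysis and lower bounds for pattern probabilities\<close>

definition step :: "nat \<Rightarrow> item list \<Rightarrow> item list pmf" where
  "step N h = (if pool N h = {} then return_pmf h
    else bind_pmf (pmf_of_set (pool N h)) (\<lambda>x. return_pmf (h @ [x])))"

text \<open>\<open>history\<close> appends the last step, whereas the induction over the future of a
  given prefix peels off the first one; \<open>run\<close> is the recursion from that side.\<close>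

primrec run :: "nat \<Rightarrow> nat \<Rightarrow> item list \<Rightarrow> item list pmf" where
  "run N 0 h = return_pmf h"
| "run N (Suc j) h = bind_pmf (step N h) (run N j)"

lemma history_Suc_eq: "history N (Suc m) = bind_pmf (history N m) (step N)"
  by (simp add: step_def[abs_def])

lemma bind_history_run: "bind_pmf (history N m) (run N j) = history N (m + j)"
proof (induction j arbitrary: m)
  case 0
  then show ?case by (simp add: bind_return_pmf')
next
  case (Suc j)
  have "run N (Suc j) = (\<lambda>h. bind_pmf (step N h) (run N j))" by auto
  then have "bind_pmf (history N m) (run N (Suc j)) = bind_pmf (history N (Suc m)) (run N j)"
    by (simp only: history_Suc_eq bind_assoc_pmf)
  also have "\<dots> = history N (m + Suc j)" using Suc.IH[of "Suc m"] by (simp del: history.simps)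
  finally show ?case .
qed

lemma history_eq_run: "history N m = run N m []"
  using bind_history_run[of N 0 m] by (simp add: bind_return_pmf)

lemma run_extends: "h' \<in> set_pmf (run N j h) \<Longrightarrow> \<exists>r. h' = h @ r"
proof (induction j arbitrary: h)
  case (Suc j)
  then obtain g where g: "g \<in> set_pmf (step N h)" "h' \<in> set_pmf (run N j g)" by auto
  moreover have "\<exists>r. g = h @ r" using g(1) by (auto simp: step_def split: if_splits)
  ultimately show ?case using Suc.IH by fastforce
qed simp

text \<open>First-step decomposition in which only the items of \<open>S\<close> are kept. For an
  empty pool the left side is 0.\<close>

lemma prob_run_Suc_ge:
  assumes fin: "finite (pool N h)" and S: "S \<subseteq> pool N h"
    and c: "\<And>x. x \<in> S \<Longrightarrow> c \<le> measure_pmf.prob (run N j (h @ [x])) E"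
  shows "real (card S) / real (card (pool N h)) * c \<le> measure_pmf.prob (run N (Suc j) h) E"
proof (cases "pool N h = {}")
  case False
  have "run N (Suc j) h = bind_pmf (pmf_of_set (pool N h)) (\<lambda>x. run N j (h @ [x]))"
    using False by (simp add: step_def bind_assoc_pmf bind_return_pmf)
  then have "measure_pmf.prob (run N (Suc j) h) E =
      measure_pmf.expectation (pmf_of_set (pool N h)) (\<lambda>x. measure_pmf.prob (run N j (h @ [x])) E)"
    by (simp only:) (subst measure_pmf_bind, subst measure_pmf.measure_bind[where N = "count_space UNIV"],
      auto intro: measure_pmf_in_subprob_algebra)
  also have "\<dots> = (\<Sum>x\<in>pool N h. measure_pmf.prob (run N j (h @ [x])) E) / real (card (pool N h))"
    using False fin by (rule integral_pmf_of_set)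
  also have "\<dots> \<ge> (\<Sum>x\<in>S. c) / real (card (pool N h))"
    using S fin c by (intro divide_right_mono order_trans[OF sum_mono[OF c] sum_mono2]) auto
  finally show ?thesis by simp
qed (use S in auto)

text \<open>An index \<open>i\<close> below \<open>L\<close> belongs to \<open>B\<close> when
  exactly one edge is occupied between the arrivals of the vertices labelled i and i + 1; for the
  other indices below \<open>L\<close> there is none.\<close>

definition edge_pattern :: "nat \<Rightarrow> nat \<Rightarrow> nat set \<Rightarrow> item list set" where
  "edge_pattern N L B = {h. \<forall>i\<le>L. edges_at N i h = card (B \<inter> {..<i})}"

text \<open>Occupied edges only shrink the pool, so ignoring them gives a lower bound that does not
  depend on the edges drawn so far.\<close>

lemma prob_next_vertex_ge:
  assumes h: "valid_history N h" and i: "vertex_count h = i" "i < N"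
    and c: "0 \<le> c" "\<And>v. Vertex v \<in> pool N h \<Longrightarrow> c \<le> measure_pmf.prob (run N j (h @ [Vertex v])) E"
  shows "real (N - i) / (real (N - i) + real (i choose 2)) * c \<le> measure_pmf.prob (run N (Suc j) h) E"
proof -
  have "real (N - i) / (real (N - i) + real (i choose 2)) * c \<le> real (N - i) / real (card (pool N h)) * c"
    using i c(1) edge_count_le[OF h]
    by (intro mult_right_mono divide_left_mono mult_pos_pos) (auto simp: card_pool[OF h])
  also have "\<dots> \<le> measure_pmf.prob (run N (Suc j) h) E"
    using prob_run_Suc_ge[OF finite_pool[OF h], of "Vertex ` ({..<N} - occupied_vertices h)" c j E]
      c(2) unfolding card_free_vertices[OF h] i(1) pool_eq by blast
  finally show ?thesis .
qed

text \<open>Every index outside \<open>B\<close> asks for a vertex next, every index in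
  \<open>B\<close> for an edge and then a vertex. When an edge is due, fewer than
  \<open>card B\<close> edges are occupied, so \<open>p i\<close> is a lower bound for its
  probability. After \<open>L\<close> vertices the pattern is settled, whatever the remaining steps
  do.\<close>

lemma prob_run_edge_pattern_ge:
  assumes "valid_history N h" "vertex_count h = i" "i \<le> L" "L \<le> N" "2 * (L - i) \<le> j"
    and "edge_count h = card (B \<inter> {..<i})"
    and "\<And>i'. i' \<le> i \<Longrightarrow> edges_at N i' h = card (B \<inter> {..<i'})"
    and "finite B"
    and p: "\<And>i. i \<in> B \<Longrightarrow> 0 \<le> p i \<and>
      p i \<le> (real (i choose 2) - real (card B)) / (real (N - i) + real (i choose 2))"
  shows "(\<Prod>i'\<in>{i..<L}. real (N - i') / (real (N - i') + real (i' choose 2)) * (if i' \<in> B then p i' else 1))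
    \<le> measure_pmf.prob (run N j h) (edge_pattern N L B)"
  using assms(1-7)
proof (induction "L - i" arbitrary: i h j)
  case 0
  then have i: "i = L" by simp
  have "set_pmf (run N j h) \<subseteq> edge_pattern N L B"
  proof
    fix h' assume "h' \<in> set_pmf (run N j h)"
    then obtain r where "h' = h @ r" using run_extends by blast
    then show "h' \<in> edge_pattern N L B"
      using 0 i by (simp add: edge_pattern_def edges_at_append)
  qed
  then have "measure_pmf.prob (run N j h) (edge_pattern N L B) = 1"
    by (simp add: measure_pmf.prob_eq_1 AE_measure_pmf_iff subset_eq)
  then show ?case using i by simp
next
  case (Suc d)
  let ?q = "\<lambda>i. real (N - i) / (real (N - i) + real (i choose 2))"
  let ?P = "\<Prod>i'\<in>{Suc i..<L}. ?q i' * (if i' \<in> B then p i' else 1)"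
  have i: "i < L" "i < N" using Suc by auto
  have P0: "0 \<le> ?P" using p by (intro prod_nonneg) auto
  \<comment> \<open>Two steps are reserved for the current index; outside \<open>B\<close> one of
    them is left over.\<close>
  obtain j' where j: "j = Suc (Suc j')" "2 * (L - Suc i) \<le> j'"
  proof (rule that[of "j - 2"])
    show "j = Suc (Suc (j - 2))" "2 * (L - Suc i) \<le> j - 2" using Suc.prems(5) i(1) by arith+
  qed
  \<comment> \<open>The induction hypothesis after the next vertex. Here \<open>g\<close> is
    \<open>h\<close> itself or \<open>h\<close> with one new edge, so that one fact serves both
    cases.\<close>
  have vertex: "?P \<le> measure_pmf.prob (run N j'' (g @ [Vertex v])) (edge_pattern N L B)"
    if g: "valid_history N g" "vertex_count g = i" "edge_count g = card (B \<inter> {..<Suc i})"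
      and v: "Vertex v \<in> pool N g" and gh: "g = h @ r" and j'': "2 * (L - Suc i) \<le> j''" for g v r j''
  proof (rule Suc.hyps(1))
    show "edges_at N i' (g @ [Vertex v]) = card (B \<inter> {..<i'})" if "i' \<le> Suc i" for i'
    proof (cases "i' = Suc i")
      case True
      then show ?thesis using edges_at_snoc[OF g(2) i(2)] g(3) by simp
    next
      case False
      then have "edges_at N i' (g @ [Vertex v]) = edges_at N i' (h @ r @ [Vertex v])" using gh by simp
      also have "\<dots> = edges_at N i' h" using False that Suc.prems i by (intro edges_at_append) auto
      also have "\<dots> = card (B \<inter> {..<i'})" using False that Suc.prems by simp
      finally show ?thesis .
    qed
  qed (use Suc i g j'' valid_history_snoc[OF g(1) v] in \<open>auto simp: vertex_count_append edge_count_append\<close>)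
  have split: "(\<Prod>i'\<in>{i..<L}. ?q i' * (if i' \<in> B then p i' else 1)) =
     ?q i * (if i \<in> B then p i else 1) * ?P"
    by (rule prod.atLeast_Suc_lessThan[OF i(1)])
  show ?case
  proof (cases "i \<in> B")
    case False
    then have "B \<inter> {..<Suc i} = B \<inter> {..<i}" by (auto simp: less_Suc_eq)
    then have "?q i * ?P \<le> measure_pmf.prob (run N (Suc (Suc j')) h) (edge_pattern N L B)"
      using Suc.prems i j
      by (intro prob_next_vertex_ge P0 vertex[where r = "[]"]) auto
    then show ?thesis using split False j by simp
  next
    case True
    then have "B \<inter> {..<Suc i} = insert i (B \<inter> {..<i})" by (auto simp: less_Suc_eq)
    then have cB: "card (B \<inter> {..<Suc i}) = Suc (edge_count h)" using Suc.prems by simp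
    have cB': "card (B \<inter> {..<Suc i}) \<le> card B" using assms(8) by (intro card_mono) auto
    have edge: "?q i * ?P \<le> measure_pmf.prob (run N (Suc j') (h @ [x])) (edge_pattern N L B)"
      if x: "x \<in> Edge ` (possible_edges h - occupied_edges h)" for x
    proof -
      have xp: "x \<in> pool N h" using x by (simp add: pool_eq)
      have xc: "vertex_count (h @ [x]) = i" "edge_count (h @ [x]) = card (B \<inter> {..<Suc i})"
        using x cB Suc.prems by (auto simp: vertex_count_append edge_count_append)
      show ?thesis
        using valid_history_snoc[OF Suc.prems(1) xp] xc i P0 j
        by (intro prob_next_vertex_ge vertex[where r = "[x]"]) auto
    qed
    have "p i \<le> (real (i choose 2) - real (card B)) / (real (N - i) + real (i choose 2))"
      using p True by blast
    also have "\<dots> \<le> real ((i choose 2) - edge_count h) / real (card (pool N h))"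
    proof -
      have "edge_count h \<le> i choose 2" using edge_count_le[OF Suc.prems(1)] Suc.prems(2) by simp
      then show ?thesis
        unfolding card_pool[OF Suc.prems(1)] Suc.prems(2)
        using cB cB' i by (intro frac_le) (auto simp: of_nat_diff)
    qed
    finally have "p i * (?q i * ?P) \<le> real ((i choose 2) - edge_count h) / real (card (pool N h)) * (?q i * ?P)"
      using P0 by (intro mult_right_mono) auto
    also have "\<dots> \<le> measure_pmf.prob (run N (Suc (Suc j')) h) (edge_pattern N L B)"
      using prob_run_Suc_ge[OF finite_pool[OF Suc.prems(1)], of "Edge ` (possible_edges h - occupied_edges h)"
          "?q i * ?P" "Suc j'" "edge_pattern N L B"] edge
      by (simp add: card_free_edges[OF Suc.prems(1)] Suc.prems(2) pool_eq)
    finally show ?thesis using split True j by (simp add: mult_ac)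
  qed
qed

text \<open>\<open>2 * L \<le> N\<close> ensures both that \<open>L\<close> vertices exist and that
  a full run is long enough for two steps per index.\<close>

lemma prob_edge_pattern_ge:
  assumes L: "2 * L \<le> N" and B: "finite B"
    and p: "\<And>i. i \<in> B \<Longrightarrow> 0 \<le> p i \<and>
      p i \<le> (real (i choose 2) - real (card B)) / (real (N - i) + real (i choose 2))"
  shows "(\<Prod>i<L. real (N - i) / (real (N - i) + real (i choose 2)) * (if i \<in> B then p i else 1))
    \<le> measure_pmf.prob (full_history N) (edge_pattern N L B)"
proof -
  have "valid_history N []"
    by (simp add: valid_history_def occupied_vertices_def occupied_edges_def)
  then show ?thesis
    using prob_run_edge_pattern_ge[of N "[]" 0 L "N + (N choose 2)" B p] L B p
    by (simp add: full_history_def history_eq_run vertex_count_def edge_count_def edges_at_def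
        atLeast0LessThan)
qed

section \<open>Jump patterns of the Poisson process\<close>

context nonhomogeneous_poisson_process
begin

lemma counting_path_sample: "\<omega> \<in> space M \<Longrightarrow> counting_path (\<lambda>t. Y t \<omega>)"
  using nondecreasing right_continuous by (simp add: counting_path_def)

lemma measurable_path:
  "(\<lambda>\<omega>. \<lambda>t\<in>{0..}. real (Y t \<omega>)) \<in> M \<rightarrow>\<^sub>M borel_of skorohod_topology"
  unfolding skorohod_topology_def
proof (rule Skorohod.measurable_borel_of_limit
    \<comment> \<open>Mesh 1 / n up to time n: the mesh shrinks while the horizon n * n / n
      grows.\<close>
    [where Z = "\<lambda>n \<omega>. \<lambda>t\<in>{0..}. real (sampled (real n) (n * n) (\<lambda>t. Y t \<omega>) t)"])
  have "filterlim (\<lambda>n. real (n * n) / real n) at_top sequentially"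
    by (subst filterlim_cong[OF refl refl, where g = real])
      (auto simp: filterlim_real_sequentially)
  then show "(\<lambda>n. skorohod_dist (\<lambda>t\<in>{0..}. real (Y t \<omega>))
      (\<lambda>t\<in>{0..}. real (sampled (real n) (n * n) (\<lambda>t. Y t \<omega>) t))) \<longlonglongrightarrow> 0" if "\<omega> \<in> space M" for \<omega>
    using counting_path_sample[OF that]
    by (intro tendsto_skorohod_dist_sampled filterlim_real_sequentially)
qed (auto intro!: counting_path_in_skorohod_paths counting_path_sample sampled_in_skorohod_paths
    sampled_vimage_measurable random_variable)

definition cell_mean :: "real \<Rightarrow> nat \<Rightarrow> real" where
  "cell_mean a i = integral {real i / a..real (Suc i) / a} rate"

definition cell_count :: "real \<Rightarrow> nat \<Rightarrow> 'a \<Rightarrow> nat" where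
  "cell_count a i \<omega> = Y (real (Suc i) / a) \<omega> - Y (real i / a) \<omega>"

definition count_pattern :: "real \<Rightarrow> nat \<Rightarrow> nat set \<Rightarrow> 'a set" where
  "count_pattern a L B = {\<omega> \<in> space M. \<forall>i\<le>L. Y (real i / a) \<omega> = card (B \<inter> {..<i})}"

context
  fixes a :: real assumes a: "0 < a"
begin

lemma cell_bounds: "0 \<le> real i / a" "real i / a \<le> real (Suc i) / a"
  using a by (auto intro: divide_right_mono)

lemma prob_cell_count:
  "prob {\<omega> \<in> space M. cell_count a i \<omega> = k} = cell_mean a i ^ k / fact k * exp (- cell_mean a i)"
  unfolding cell_count_def cell_mean_def by (rule poisson_increments[OF cell_bounds])

lemma cell_count_measurable: "cell_count a i \<in> M \<rightarrow>\<^sub>M count_space UNIV"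
proof -
  have "(\<lambda>\<omega>. (Y (real (Suc i) / a) \<omega>, Y (real i / a) \<omega>)) \<in> M \<rightarrow>\<^sub>M count_space UNIV \<Otimes>\<^sub>M count_space UNIV"
    using a by (intro measurable_Pair random_variable) auto
  then have "(\<lambda>\<omega>. (Y (real (Suc i) / a) \<omega>, Y (real i / a) \<omega>)) \<in> M \<rightarrow>\<^sub>M count_space UNIV"
    by (simp add: pair_measure_countable)
  from measurable_compose[OF this, of "\<lambda>(x, y). x - y" "count_space UNIV"]
  show ?thesis by (simp add: cell_count_def[abs_def])
qed

lemma cell_count_sets: "{\<omega> \<in> space M. cell_count a i \<omega> \<in> A} \<in> events"
proof -
  have "cell_count a i -` A \<inter> space M \<in> events"
    by (rule measurable_sets[OF cell_count_measurable]) simp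
  moreover have "cell_count a i -` A \<inter> space M = {\<omega> \<in> space M. cell_count a i \<omega> \<in> A}" by blast
  ultimately show ?thesis by (simp only:)
qed

text \<open>The sign is read off from the probability m * exp (- m) that the cell contains exactly
  one jump.\<close>

lemma cell_mean_nonneg: "0 \<le> cell_mean a i"
proof -
  have "0 \<le> cell_mean a i * exp (- cell_mean a i)"
    using prob_cell_count[of i 1] measure_nonneg[of M "{\<omega> \<in> space M. cell_count a i \<omega> = 1}"] by simp
  then show ?thesis by (simp add: zero_le_mult_iff)
qed

text \<open>Both bounds follow from \<open>exp (- m) \<ge> 1 - m\<close>; the second one is 1 - (1 +
  m) * (1 - m) = m^2.\<close>

lemma prob_cell_count_ge:
  "prob {\<omega> \<in> space M. 1 \<le> cell_count a i \<omega>} \<le> cell_mean a i"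
  "prob {\<omega> \<in> space M. 2 \<le> cell_count a i \<omega>} \<le> cell_mean a i ^ 2"
proof -
  let ?m = "cell_mean a i"
  have ev: "{\<omega> \<in> space M. cell_count a i \<omega> = k} \<in> events" for k
    using cell_count_sets[of i "{k}"] by simp
  have "{\<omega> \<in> space M. 1 \<le> cell_count a i \<omega>} = space M - {\<omega> \<in> space M. cell_count a i \<omega> = 0}" by auto
  then have "prob {\<omega> \<in> space M. 1 \<le> cell_count a i \<omega>} = 1 - exp (- ?m)"
    using prob_cell_count[of i 0] by (simp only: prob_compl[OF ev]) simp
  also have "\<dots> \<le> ?m" using exp_ge_add_one_self[of "- ?m"] by simp
  finally show "prob {\<omega> \<in> space M. 1 \<le> cell_count a i \<omega>} \<le> ?m" .
  have "{\<omega> \<in> space M. 2 \<le> cell_count a i \<omega>} = space M -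
      ({\<omega> \<in> space M. cell_count a i \<omega> = 0} \<union> {\<omega> \<in> space M. cell_count a i \<omega> = 1})" by auto
  moreover have "prob ({\<omega> \<in> space M. cell_count a i \<omega> = 0} \<union> {\<omega> \<in> space M. cell_count a i \<omega> = 1})
      = (1 + ?m) * exp (- ?m)"
    using prob_cell_count[of i 0] prob_cell_count[of i 1]
    by (subst finite_measure_Union[OF ev ev]) (auto simp: algebra_simps)
  ultimately have "prob {\<omega> \<in> space M. 2 \<le> cell_count a i \<omega>} = 1 - (1 + ?m) * exp (- ?m)"
    using prob_compl[OF sets.Un[OF ev ev]] by simp
  also have "\<dots> \<le> 1 - (1 + ?m) * (1 - ?m)"
    using exp_ge_add_one_self[of "- ?m"] cell_mean_nonneg[of i]
    by (intro diff_left_mono mult_left_mono) auto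
  also have "\<dots> = ?m ^ 2" by (simp add: algebra_simps power2_eq_square)
  finally show "prob {\<omega> \<in> space M. 2 \<le> cell_count a i \<omega>} \<le> ?m ^ 2" .
qed

text \<open>Passing from the values of \<open>Y\<close> to its increments makes independence
  applicable.\<close>

lemma count_pattern_eq:
  "count_pattern a L B = {\<omega> \<in> space M. \<forall>i<L. cell_count a i \<omega> = (if i \<in> B then 1 else 0)}"
proof -
  have cS: "card (B \<inter> {..<Suc i}) = card (B \<inter> {..<i}) + (if i \<in> B then 1 else 0)" for i
  proof (cases "i \<in> B")
    case True
    then have "B \<inter> {..<Suc i} = insert i (B \<inter> {..<i})" by (auto simp: less_Suc_eq)
    then show ?thesis using True by simp
  next
    case False
    then have "B \<inter> {..<Suc i} = B \<inter> {..<i}" by (auto simp: less_Suc_eq)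
    then show ?thesis using False by simp
  qed
  show ?thesis
  proof (intro equalityI subsetI)
    fix \<omega> assume "\<omega> \<in> count_pattern a L B"
    then show "\<omega> \<in> {\<omega> \<in> space M. \<forall>i<L. cell_count a i \<omega> = (if i \<in> B then 1 else 0)}"
      by (auto simp: count_pattern_def cell_count_def cS simp del: of_nat_Suc)
  next
    fix \<omega> assume "\<omega> \<in> {\<omega> \<in> space M. \<forall>i<L. cell_count a i \<omega> = (if i \<in> B then 1 else 0)}"
    then have \<omega>: "\<omega> \<in> space M" "\<And>i. i < L \<Longrightarrow> cell_count a i \<omega> = (if i \<in> B then 1 else 0)" by auto
    have "i \<le> L \<Longrightarrow> Y (real i / a) \<omega> = card (B \<inter> {..<i})" for i
    proof (induction i)
      case 0
      then show ?case using starts_at_0[OF \<omega>(1)] by simp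
    next
      case (Suc i)
      have "Y (real i / a) \<omega> \<le> Y (real (Suc i) / a) \<omega>"
        using cell_bounds by (intro counting_path_mono[OF counting_path_sample[OF \<omega>(1)]])
      then show ?case using Suc \<omega>(2)[of i] by (simp add: cell_count_def cS del: of_nat_Suc)
    qed
    then show "\<omega> \<in> count_pattern a L B" using \<omega>(1) by (simp add: count_pattern_def)
  qed
qed

lemma count_pattern_event: "count_pattern a L B \<in> events"
proof -
  have "{\<omega> \<in> space M. \<forall>i\<in>{..<L}. cell_count a i \<omega> = (if i \<in> B then 1 else 0)} \<in> events"
  proof (rule sets.sets_Collect_finite_All)
    fix i
    show "{\<omega> \<in> space M. cell_count a i \<omega> = (if i \<in> B then 1 else 0)} \<in> events"
      using cell_count_sets[of i "{if i \<in> B then 1 else 0}"] by (simp only: singleton_iff)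
  qed simp
  moreover have "count_pattern a L B =
      {\<omega> \<in> space M. \<forall>i\<in>{..<L}. cell_count a i \<omega> = (if i \<in> B then 1 else 0)}"
    unfolding count_pattern_eq by blast
  ultimately show ?thesis by (simp only:)
qed

lemma prob_count_pattern:
  "prob (count_pattern a L B) =
    (\<Prod>i<L. exp (- cell_mean a i) * (if i \<in> B then cell_mean a i else 1))"
\<comment> \<open>An intersection over no cells would be \<open>UNIV\<close> rather than
  \<open>space M\<close>, hence the separate case.\<close>
proof (cases "L = 0")
  case True
  then show ?thesis by (simp add: count_pattern_eq prob_space)
next
  case False
  let ?A = "\<lambda>i. cell_count a i -` {if i \<in> B then 1 else 0} \<inter> space M"
  have "mono (\<lambda>i. real i / a)" using a by (auto simp: mono_def intro: divide_right_mono)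
  then have "indep_vars (\<lambda>_. count_space UNIV) (cell_count a) {..<L}"
    using independent_increments[of "\<lambda>i. real i / a" L] by (simp add: cell_count_def[abs_def])
  then have "prob (\<Inter>i\<in>{..<L}. ?A i) = (\<Prod>i<L. prob (?A i))"
    using False by (intro indep_varsD) auto
  also have "(\<Inter>i\<in>{..<L}. ?A i) = count_pattern a L B"
    using False unfolding count_pattern_eq by blast
  also have "(\<Prod>i<L. prob (?A i)) =
    (\<Prod>i<L. exp (- cell_mean a i) * (if i \<in> B then cell_mean a i else 1))"
  proof (rule prod.cong[OF refl])
    fix i
    have "?A i = {\<omega> \<in> space M. cell_count a i \<omega> = (if i \<in> B then 1 else 0)}" by blast
    then show "prob (?A i) = exp (- cell_mean a i) * (if i \<in> B then cell_mean a i else 1)"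
      by (simp only: prob_cell_count) simp
  qed
  finally show ?thesis .
qed

end

end

text \<open>\<open>I\<close> bounds the relative error made at each element of \<open>B\<close>, and
  \<open>k\<close> bounds how many such errors are multiplied.\<close>

definition sparse_patterns :: "nat \<Rightarrow> real \<Rightarrow> real \<Rightarrow> nat set set" where
  "sparse_patterns L I k = {B. B \<subseteq> {..<L} \<and> (\<forall>i\<in>B. I \<le> real i) \<and> real (card B) \<le> k}"

lemma finite_sparse_patterns: "finite (sparse_patterns L I k)"
  by (rule finite_subset[of _ "Pow {..<L}"]) (auto simp: sparse_patterns_def)

text \<open>An outcome outside all sparse patterns has two jumps in one cell (\<open>?A1\<close>), a
  jump in a cell of index below \<open>I\<close> (\<open>?A2\<close>), or at least \<open>k\<close>
  occupied cells (\<open>?A3\<close>). The first two are handled by union bounds, the third by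
  Markov's inequality.\<close>

lemma (in nonhomogeneous_poisson_process) prob_not_sparse_le:
  assumes a: "0 < a" and k: "0 < k"
  shows "prob (space M - (\<Union>B\<in>sparse_patterns L I k. count_pattern a L B)) \<le>
    (\<Sum>i<L. cell_mean a i ^ 2) + (\<Sum>i\<in>{i. i < L \<and> real i < I}. cell_mean a i) +
    (\<Sum>i<L. cell_mean a i) / k"
proof -
  let ?A1 = "\<Union>i\<in>{..<L}. {\<omega> \<in> space M. 2 \<le> cell_count a i \<omega>}"
  let ?A2 = "\<Union>i\<in>{i. i < L \<and> real i < I}. {\<omega> \<in> space M. 1 \<le> cell_count a i \<omega>}"
  define S where "S \<omega> = (\<Sum>i<L. indicator {\<omega> \<in> space M. 1 \<le> cell_count a i \<omega>} \<omega> :: real)" for \<omega>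
  let ?A3 = "{\<omega> \<in> space M. k \<le> S \<omega>}"
  have ge: "{\<omega> \<in> space M. j \<le> cell_count a i \<omega>} \<in> events" for i j
    using cell_count_sets[OF a, of i "{j..}"] by simp
  have A1: "?A1 \<in> events" and A2: "?A2 \<in> events" using ge by auto
  have S: "S \<in> borel_measurable M"
    unfolding S_def[abs_def] using ge by (intro borel_measurable_sum borel_measurable_indicator)
  then have A3: "?A3 \<in> events" by measurable
  have "space M - (\<Union>B\<in>sparse_patterns L I k. count_pattern a L B) \<subseteq> ?A1 \<union> ?A2 \<union> ?A3"
  proof
    fix \<omega> assume \<omega>: "\<omega> \<in> space M - (\<Union>B\<in>sparse_patterns L I k. count_pattern a L B)"
    define B where "B = {i. i < L \<and> 1 \<le> cell_count a i \<omega>}"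
    show "\<omega> \<in> ?A1 \<union> ?A2 \<union> ?A3"
    proof (rule ccontr)
      assume n: "\<omega> \<notin> ?A1 \<union> ?A2 \<union> ?A3"
      have "S \<omega> = real (card B)"
      proof -
        have "S \<omega> = (\<Sum>i<L. if i \<in> B then 1 else 0)"
          unfolding S_def using \<omega> by (intro sum.cong) (auto simp: B_def indicator_def)
        also have "\<dots> = real (card B)"
          by (subst sum.If_cases) (auto simp: B_def Int_def intro!: arg_cong[where f = card])
        finally show ?thesis .
      qed
      moreover have "S \<omega> < k"
      proof (rule ccontr)
        assume "\<not> S \<omega> < k"
        then have "\<omega> \<in> ?A3" using \<omega> by simp
        then show False using n by blast
      qed
      moreover have "I \<le> real i" if "i \<in> B" for i
      proof (rule ccontr)
        assume "\<not> I \<le> real i"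
        then have "\<omega> \<in> ?A2" using that \<omega> unfolding B_def by (intro UN_I[of i]) auto
        then show False using n by blast
      qed
      ultimately have "B \<in> sparse_patterns L I k" by (auto simp: sparse_patterns_def B_def)
      moreover have "\<omega> \<in> count_pattern a L B"
      proof -
        have "cell_count a i \<omega> = (if i \<in> B then 1 else 0)" if "i < L" for i
        proof -
          have "\<not> 2 \<le> cell_count a i \<omega>" using n \<omega> that by blast
          then show ?thesis using that by (auto simp: B_def)
        qed
        then show ?thesis using \<omega> by (simp add: count_pattern_eq[OF a])
      qed
      ultimately show False using \<omega> by blast
    qed
  qed
  then have "prob (space M - (\<Union>B\<in>sparse_patterns L I k. count_pattern a L B)) \<le> prob (?A1 \<union> ?A2 \<union> ?A3)"
    using A1 A2 A3 by (intro finite_measure_mono) auto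
  also have "\<dots> \<le> prob ?A1 + prob ?A2 + prob ?A3"
    using measure_Un_le[OF A1 A2] measure_Un_le[OF sets.Un[OF A1 A2] A3] by linarith
  also have "prob ?A1 \<le> (\<Sum>i<L. prob {\<omega> \<in> space M. 2 \<le> cell_count a i \<omega>})"
    by (rule measure_UNION_le[OF _ ge]) simp
  also have "\<dots> \<le> (\<Sum>i<L. cell_mean a i ^ 2)"
    by (intro sum_mono prob_cell_count_ge[OF a])
  also have "prob ?A2 \<le> (\<Sum>i\<in>{i. i < L \<and> real i < I}. prob {\<omega> \<in> space M. 1 \<le> cell_count a i \<omega>})"
    by (rule measure_UNION_le[OF _ ge]) simp
  also have "\<dots> \<le> (\<Sum>i\<in>{i. i < L \<and> real i < I}. cell_mean a i)"
    by (intro sum_mono prob_cell_count_ge[OF a])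
  also have "prob ?A3 \<le> (\<Sum>i<L. cell_mean a i) / k"
  proof -
    have int: "integrable M (\<lambda>\<omega>. indicator {\<omega> \<in> space M. 1 \<le> cell_count a i \<omega>} \<omega> :: real)" for i
      using ge by (intro integrable_real_indicator) (auto simp: emeasure_eq_measure)
    have "prob ?A3 \<le> expectation S / k"
    proof (rule integral_Markov_inequality_measure[where A = "{}"])
      show "integrable M S"
        unfolding S_def[abs_def] by (intro Bochner_Integration.integrable_sum int)
      show "AE \<omega> in M. 0 \<le> S \<omega>" unfolding S_def by (intro always_eventually allI sum_nonneg) simp
    qed (use k in auto)
    also have "expectation S = (\<Sum>i<L. expectation (indicator {\<omega> \<in> space M. 1 \<le> cell_count a i \<omega>}))"
      unfolding S_def[abs_def] by (intro Bochner_Integration.integral_sum int)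
    also have "\<dots> = (\<Sum>i<L. prob {\<omega> \<in> space M. 1 \<le> cell_count a i \<omega>})"
    proof (rule sum.cong[OF refl])
      fix i
      have "{\<omega> \<in> space M. 1 \<le> cell_count a i \<omega>} \<inter> space M = {\<omega> \<in> space M. 1 \<le> cell_count a i \<omega>}" by blast
      then show "expectation (indicator {\<omega> \<in> space M. 1 \<le> cell_count a i \<omega>}) = prob {\<omega> \<in> space M. 1 \<le> cell_count a i \<omega>}"
        by (simp only: Bochner_Integration.integral_indicator)
    qed
    also have "\<dots> / k \<le> (\<Sum>i<L. cell_mean a i) / k"
      using k by (intro divide_right_mono sum_mono prob_cell_count_ge[OF a]) auto
    finally show ?thesis .
  qed
  finally show ?thesis by simp
qed

section \<open>Comparison of pattern probabilities\<close>

lemma real_choose_2: "real (i choose 2) = real i * (real i - 1) / 2"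
proof (induction i)
  case (Suc i)
  have "Suc i choose 2 = i + (i choose 2)" by (simp add: numeral_2_eq_2)
  then show ?case using Suc by (simp add: field_simps)
qed simp

text \<open>This is ((i + 1)^3 - i^3) / (6 N), the integral of t^2 / 2 over the cell from i / a to
  (i + 1) / a when a^3 = N; sums over \<open>i\<close> telescope.\<close>

definition increment_mean :: "nat \<Rightarrow> nat \<Rightarrow> real" where
  "increment_mean N i = (3 * real i ^ 2 + 3 * real i + 1) / (6 * real N)"

lemma increment_mean_nonneg: "0 \<le> increment_mean N i"
  by (simp add: increment_mean_def)

lemma sum_increment_mean: "(\<Sum>i<L. increment_mean N i) = real L ^ 3 / (6 * real N)"
proof (cases "N = 0")
  case False
  then show ?thesis
    by (induction L) (simp_all add: increment_mean_def field_simps power3_eq_cube power2_eq_square)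
qed (simp add: increment_mean_def)

text \<open>Lower bound, uniform in \<open>i \<ge> I\<close> and in at most \<open>k\<close> edges, for the ratio between the
  probability that the next item is an edge and the mean \<open>increment_mean N i\<close>.\<close>

definition success_factor :: "nat \<Rightarrow> nat \<Rightarrow> real \<Rightarrow> real \<Rightarrow> real" where
  "success_factor N L I k =
    (1 - (7 / (3 * I) + 2 * k / I ^ 2)) * (real N / (real N + real L ^ 2))"

text \<open>The exponential collects the loss of the vertex draws at all indices, the second factor
  the loss of the edge draws at the indices in \<open>B\<close>.\<close>

definition pattern_ratio :: "nat \<Rightarrow> nat \<Rightarrow> real \<Rightarrow> real \<Rightarrow> real" where
  "pattern_ratio N L I k =
    exp (- (real L ^ 3 / (6 * real N) * (real L / (real N - real L)))) *
    (1 - k * (1 - success_factor N L I k))"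

text \<open>With \<open>x\<close> the ratio of edges to free vertices, the right side is 1 / (1 +
  x), which is at least exp (- x).\<close>

lemma prob_no_edge_ge:
  assumes "i < L" "L < N"
  shows "exp (- increment_mean N i * (real N / (real N - real L)))
    \<le> real (N - i) / (real (N - i) + real (i choose 2))"
proof -
  define x where "x = real (i choose 2) / real (N - i)"
  have Ni: "0 < real (N - i)" using assms by simp
  have x: "0 \<le> x" by (simp add: x_def)
  have "real (i choose 2) \<le> increment_mean N i * real N"
    using assms by (simp add: real_choose_2 increment_mean_def field_simps power2_eq_square)
  then have "x \<le> increment_mean N i * real N / (real N - real L)"
    unfolding x_def using assms increment_mean_nonneg[of N i]
    by (intro frac_le mult_nonneg_nonneg) (auto simp: of_nat_diff)
  then have "exp (- increment_mean N i * (real N / (real N - real L))) \<le> exp (- x)" by simp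
  also have "\<dots> = 1 / exp x" by (simp add: exp_minus field_simps)
  also have "\<dots> \<le> 1 / (1 + x)" using x exp_ge_add_one_self[of x] by (intro divide_left_mono) auto
  also have "\<dots> = real (N - i) / (real (N - i) + real (i choose 2))"
    unfolding x_def using Ni by (simp add: field_simps)
  finally show ?thesis .
qed

lemma prob_one_edge_ge:
  assumes iL: "i < L" "L < N" and I: "1 \<le> I" "I \<le> real i" and k: "real j \<le> k"
    and small: "7 / (3 * I) + 2 * k / I ^ 2 \<le> 1"
  shows "success_factor N L I k * increment_mean N i
    \<le> (real (i choose 2) - real j) / (real (N - i) + real (i choose 2))"
proof -
  define r where "r = 7 / (3 * I) + 2 * k / I ^ 2"
  define q where "q = 3 * real i ^ 2 + 3 * real i + 1"
  have k0: "0 \<le> k" using k by linarith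
  have r: "0 \<le> r" "r \<le> 1" using I k0 small by (auto simp: r_def)
  have q: "3 * real i ^ 2 \<le> q" "0 \<le> q" by (auto simp: q_def)
  \<comment> \<open>Since q / 6 exceeds i choose 2 by i + 1/6, which is at most 7/6 i, the left side
    bounds the total deficit including the occupied edges. The two summands of \<open>r\<close> are
    made so that, for i at least \<open>I\<close>, they absorb one part each.\<close>
  have "7 / 6 * real i + k \<le> r * (real i ^ 2 / 2)"
  proof -
    have "real i * I \<le> real i ^ 2" unfolding power2_eq_square using I by (intro mult_left_mono) auto
    then have "7 / 6 * real i \<le> 7 / (3 * I) * (real i ^ 2 / 2)" using I by (simp add: field_simps)
    moreover have "k \<le> 2 * k / I ^ 2 * (real i ^ 2 / 2)"
    proof -
      have "k * I ^ 2 \<le> k * real i ^ 2" using I k0 by (intro mult_left_mono power_mono) auto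
      then show ?thesis using I by (simp add: field_simps)
    qed
    ultimately show ?thesis unfolding r_def by (simp add: distrib_right)
  qed
  also have "\<dots> \<le> r * (q / 6)" using r q by (intro mult_left_mono) auto
  finally have "(1 - r) * (q / 6) \<le> q / 6 - 7 / 6 * real i - k" by (simp add: left_diff_distrib)
  also have "\<dots> \<le> real (i choose 2) - real j"
    using I k by (simp add: q_def real_choose_2 field_simps power2_eq_square)
  finally have num: "(1 - r) * (q / 6) \<le> real (i choose 2) - real j" .
  have "real i ^ 2 \<le> real L ^ 2" using iL by (intro power_mono) auto
  moreover have "real i * (real i - 1) / 2 \<le> real i ^ 2"
    by (simp add: power2_eq_square field_simps)
  ultimately have "real i * (real i - 1) / 2 \<le> real L ^ 2" by (rule order_trans[rotated])
  then have den: "real (N - i) + real (i choose 2) \<le> real N + real L ^ 2"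
    using iL by (simp add: real_choose_2 of_nat_diff)
  have "success_factor N L I k * increment_mean N i = (1 - r) * (q / 6) / (real N + real L ^ 2)"
    using iL by (simp add: success_factor_def increment_mean_def r_def q_def)
  also have "\<dots> \<le> (real (i choose 2) - real j) / (real (N - i) + real (i choose 2))"
  proof (rule frac_le[OF _ num _ den])
    have "0 \<le> (1 - r) * (q / 6)" using r q by simp
    then show "0 \<le> real (i choose 2) - real j" using num by linarith
    show "0 < real (N - i) + real (i choose 2)" using iL by simp
  qed
  finally show ?thesis .
qed

text \<open>The second product is the probability that \<open>Y\<close> follows \<open>B\<close>.
  Both sides are products over the indices, so the comparison is made factor by factor; Bernoulli's
  inequality bounds the power of the success factor uniformly in \<open>B\<close>.\<close>

lemma pattern_ratio_le:
  assumes L: "0 < N" "2 * L \<le> N" and I: "1 \<le> I" and k: "0 \<le> k"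
    and small: "7 / (3 * I) + 2 * k / I ^ 2 \<le> 1" and B: "B \<in> sparse_patterns L I k"
  shows "pattern_ratio N L I k *
      (\<Prod>i<L. exp (- increment_mean N i) * (if i \<in> B then increment_mean N i else 1))
    \<le> measure_pmf.prob (full_history N) (edge_pattern N L B)"
proof -
  define \<theta> where "\<theta> = success_factor N L I k"
  let ?m = "increment_mean N"
  let ?l = "real L / (real N - real L)"
  have LN: "L < N" using L by linarith
  have B': "B \<subseteq> {..<L}" "finite B" "real (card B) \<le> k" "\<And>i. i \<in> B \<Longrightarrow> I \<le> real i"
    using B by (auto simp: sparse_patterns_def intro: finite_subset)
  have \<theta>: "0 \<le> \<theta>" "\<theta> \<le> 1"
  proof -
    have "0 \<le> 7 / (3 * I) + 2 * k / I ^ 2" using I k by simp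
    moreover have "real N / (real N + real L ^ 2) \<le> 1"
      using L by (simp add: divide_le_eq_1 add_pos_nonneg)
    ultimately show "\<theta> \<le> 1"
      unfolding \<theta>_def success_factor_def by (intro mult_le_one) (simp_all add: add_nonneg_nonneg)
    show "0 \<le> \<theta>"
      unfolding \<theta>_def success_factor_def using small by (intro mult_nonneg_nonneg) simp_all
  qed
  have "pattern_ratio N L I k \<le> exp (- ((\<Sum>i<L. ?m i) * ?l)) * \<theta> ^ card B"
  proof -
    have "1 - k * (1 - \<theta>) \<le> 1 - real (card B) * (1 - \<theta>)"
      using B'(3) \<theta> by (intro diff_left_mono mult_right_mono) auto
    also have "\<dots> \<le> \<theta> ^ card B"
      using Bernoulli_inequality[of "\<theta> - 1" "card B"] \<theta> by (simp add: algebra_simps)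
    finally show ?thesis
      unfolding pattern_ratio_def sum_increment_mean \<theta>_def by (intro mult_left_mono) auto
  qed
  then have "pattern_ratio N L I k * (\<Prod>i<L. exp (- ?m i) * (if i \<in> B then ?m i else 1))
    \<le> (exp (- ((\<Sum>i<L. ?m i) * ?l)) * \<theta> ^ card B) * (\<Prod>i<L. exp (- ?m i) * (if i \<in> B then ?m i else 1))"
    by (intro mult_right_mono prod_nonneg) (auto simp: increment_mean_nonneg)
  also have "exp (- ((\<Sum>i<L. ?m i) * ?l)) = (\<Prod>i<L. exp (- ?m i * ?l))"
    by (simp add: exp_sum[symmetric] sum_distrib_right sum_negf sum_divide_distrib)
  also have "\<theta> ^ card B = (\<Prod>i<L. if i \<in> B then \<theta> else 1)"
    using B'(1) by (simp add: prod.If_cases Int_absorb1)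
  also have "(\<Prod>i<L. exp (- ?m i * ?l)) * (\<Prod>i<L. if i \<in> B then \<theta> else 1) *
      (\<Prod>i<L. exp (- ?m i) * (if i \<in> B then ?m i else 1)) =
      (\<Prod>i<L. exp (- ?m i * (real N / (real N - real L))) * (if i \<in> B then \<theta> * ?m i else 1))"
  proof -
    \<comment> \<open>This splits the exponent into the Poisson factor exp (- m) and the part
      charged to \<open>pattern_ratio\<close>.\<close>
    have "real N / (real N - real L) = 1 + ?l" using LN by (simp add: field_simps)
    then have "exp (- ?m i * (real N / (real N - real L))) = exp (- ?m i * ?l) * exp (- ?m i)" for i
      by (simp only: exp_add[symmetric]) (simp add: algebra_simps)
    then show ?thesis
      unfolding prod.distrib[symmetric] by (intro prod.cong) auto
  qed
  also have "\<dots> \<le> (\<Prod>i<L. real (N - i) / (real (N - i) + real (i choose 2)) * (if i \<in> B then \<theta> * ?m i else 1))"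
    using LN \<theta> increment_mean_nonneg[of N]
    by (intro prod_mono conjI mult_mono prob_no_edge_ge) auto
  also have "\<dots> \<le> measure_pmf.prob (full_history N) (edge_pattern N L B)"
    using B' \<theta> LN increment_mean_nonneg[of N] I small unfolding \<theta>_def
    by (intro prob_edge_pattern_ge L conjI prob_one_edge_ge) auto
  finally show ?thesis .
qed

section \<open>Pattern paths and lower envelopes of test functions\<close>

lemma rescaled_edge_path_in_skorohod_paths: "rescaled_edge_path N h \<in> skorohod_paths"
  unfolding rescaled_edge_path_def
  by (rule step_path_in_skorohod_paths[where F = "\<lambda>i. real (edges_at N i h)"]) simp

text \<open>The meeting point of the two processes: the sampled \<open>Y\<close> equals this path on
  its pattern event, and the rescaled \<open>X\<close> agrees with it up to time L / a.\<close>

definition pattern_path :: "real \<Rightarrow> nat \<Rightarrow> nat set \<Rightarrow> real \<Rightarrow> real" where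
  "pattern_path a L B = (\<lambda>t\<in>{0..}. real (card (B \<inter> {..<min (nat \<lfloor>t * a\<rfloor>) L})))"

lemma skorohod_dist_rescaled_edge_path_le:
  assumes h: "h \<in> edge_pattern N L B" and N: "0 < N" and K: "real K \<le> real L / root 3 (real N)"
  shows "skorohod_dist (rescaled_edge_path N h) (pattern_path (root 3 (real N)) L B) \<le> (1/2) ^ K"
proof (rule skorohod_dist_le_if_eq_upto)
  fix t :: real assume t: "0 \<le> t" "t \<le> real K"
  have r: "0 < root 3 (real N)" using N by simp
  have "t * root 3 (real N) \<le> real K * root 3 (real N)" using t r by (intro mult_right_mono) auto
  also have "\<dots> \<le> real L" using K r by (simp add: field_simps)
  finally have "nat \<lfloor>t * root 3 (real N)\<rfloor> \<le> L" by linarith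
  then show "rescaled_edge_path N h t = pattern_path (root 3 (real N)) L B t"
    using h t by (simp add: rescaled_edge_path_def pattern_path_def edge_pattern_def min_absorb1)
qed

text \<open>Membership is visible in the increments of the counts, so the events for different
  patterns are disjoint.\<close>

lemma pattern_determines_set:
  fixes L :: nat
  assumes "B \<subseteq> {..<L}" "B' \<subseteq> {..<L}" and eq: "\<And>i. i \<le> L \<Longrightarrow> card (B \<inter> {..<i}) = card (B' \<inter> {..<i})"
  shows "B = B'"
proof -
  have cS: "i \<in> C \<longleftrightarrow> card (C \<inter> {..<Suc i}) \<noteq> card (C \<inter> {..<i})" for i :: nat and C :: "nat set"
  proof (cases "i \<in> C")
    case True
    then have "C \<inter> {..<Suc i} = insert i (C \<inter> {..<i})" by (auto simp: less_Suc_eq)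
    then show ?thesis using True by simp
  next
    case False
    then have "C \<inter> {..<Suc i} = C \<inter> {..<i}" by (auto simp: less_Suc_eq)
    then show ?thesis using False by simp
  qed
  have "i \<in> B \<longleftrightarrow> i \<in> B'" if "i < L" for i
    using eq[of i] eq[of "Suc i"] that by (simp add: cS[of i])
  then show ?thesis using assms(1,2) by blast
qed

text \<open>The lower envelope of \<open>f\<close> at scale \<open>\<delta>\<close>. It bounds
  \<open>f\<close> from below at every path whose distance to the centre is at most
  \<open>\<delta>\<close>, which is all that a pattern reveals about the rescaled
  \<open>X\<close>.\<close>

definition nearby_inf :: "((real \<Rightarrow> real) \<Rightarrow> real) \<Rightarrow> real \<Rightarrow> (real \<Rightarrow> real) \<Rightarrow> real" where
  "nearby_inf f \<delta> y = Inf (f ` {x \<in> skorohod_paths. skorohod_dist x y \<le> \<delta>})"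

context
  fixes f :: "(real \<Rightarrow> real) \<Rightarrow> real" and C :: real
  assumes f: "\<And>x. x \<in> skorohod_paths \<Longrightarrow> 0 \<le> f x \<and> f x \<le> C"
begin

lemma nearby_inf_le:
  assumes "x \<in> skorohod_paths" "skorohod_dist x y \<le> \<delta>"
  shows "nearby_inf f \<delta> y \<le> f x"
  unfolding nearby_inf_def
  by (rule cINF_lower) (use assms f in \<open>auto intro!: bdd_belowI[of _ 0]\<close>)

lemma nearby_inf_ge:
  assumes "y \<in> skorohod_paths" "0 \<le> \<delta>"
    and "\<And>x. x \<in> skorohod_paths \<Longrightarrow> skorohod_dist x y \<le> \<delta> \<Longrightarrow> c \<le> f x"
  shows "c \<le> nearby_inf f \<delta> y"
proof -
  have "skorohod_dist y y = 0" using assms(1) by simp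
  then show ?thesis
    unfolding nearby_inf_def using assms by (intro cINF_greatest) auto
qed

lemma nearby_inf_bounds:
  assumes "y \<in> skorohod_paths" "0 \<le> \<delta>"
  shows "0 \<le> nearby_inf f \<delta> y" "nearby_inf f \<delta> y \<le> C"
proof -
  show "0 \<le> nearby_inf f \<delta> y" using assms f by (intro nearby_inf_ge) auto
  have "nearby_inf f \<delta> y \<le> f y" using assms by (intro nearby_inf_le) auto
  then show "nearby_inf f \<delta> y \<le> C" using f[OF assms(1)] by linarith
qed

text \<open>The pattern events are disjoint, so at most one summand is nonzero at a given history;
  where all vanish, \<open>0 \<le> f\<close> suffices.\<close>

lemma expectation_rescaled_edge_path_ge:
  assumes N: "0 < N" and K: "real K \<le> real L / root 3 (real N)"
    and S: "finite S" "\<And>B. B \<in> S \<Longrightarrow> B \<subseteq> {..<L}"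
  shows "(\<Sum>B\<in>S. nearby_inf f ((1/2) ^ K) (pattern_path (root 3 (real N)) L B) *
      measure_pmf.prob (full_history N) (edge_pattern N L B))
    \<le> measure_pmf.expectation (full_history N) (\<lambda>h. f (rescaled_edge_path N h))"
proof -
  let ?g = "\<lambda>B. nearby_inf f ((1/2) ^ K) (pattern_path (root 3 (real N)) L B)"
  have "(\<Sum>B\<in>S. ?g B * measure_pmf.prob (full_history N) (edge_pattern N L B)) =
    measure_pmf.expectation (full_history N) (\<lambda>h. \<Sum>B\<in>S. ?g B * indicator (edge_pattern N L B) h)"
    by (subst Bochner_Integration.integral_sum)
      (auto intro!: integrable_mult_right integrable_real_indicator simp: measure_pmf.emeasure_eq_measure)
  also have "\<dots> \<le> measure_pmf.expectation (full_history N) (\<lambda>h. f (rescaled_edge_path N h))"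
  proof (rule integral_mono)
    show "integrable (measure_pmf (full_history N)) (\<lambda>h. \<Sum>B\<in>S. ?g B * indicator (edge_pattern N L B) h)"
      by (auto intro!: Bochner_Integration.integrable_sum integrable_mult_right integrable_real_indicator
          simp: measure_pmf.emeasure_eq_measure)
    show "integrable (measure_pmf (full_history N)) (\<lambda>h. f (rescaled_edge_path N h))"
      using f[OF rescaled_edge_path_in_skorohod_paths]
      by (intro measure_pmf.integrable_const_bound[where B = C]) auto
    fix h
    show "(\<Sum>B\<in>S. ?g B * indicator (edge_pattern N L B) h) \<le> f (rescaled_edge_path N h)"
    proof (cases "\<exists>B\<in>S. h \<in> edge_pattern N L B")
      case True
      then obtain B where B: "B \<in> S" "h \<in> edge_pattern N L B" by blast
      have uniq: "B' = B" if "B' \<in> S" "h \<in> edge_pattern N L B'" for B'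
        using that B S(2) by (intro pattern_determines_set[of _ L]) (simp_all add: edge_pattern_def)
      have "(\<Sum>B'\<in>S. ?g B' * indicator (edge_pattern N L B') h) = (\<Sum>B'\<in>S. if B' = B then ?g B else 0)"
      proof (rule sum.cong[OF refl])
        fix B' assume B': "B' \<in> S"
        show "?g B' * indicator (edge_pattern N L B') h = (if B' = B then ?g B else 0)"
        proof (cases "B' = B")
          case True
          then show ?thesis by (simp only: True indicator_simps(1)[OF B(2)] if_True mult_1_right)
        next
          case False
          then have "h \<notin> edge_pattern N L B'" using uniq[OF B'] by blast
          then show ?thesis using False by simp
        qed
      qed
      also have "\<dots> = ?g B" using B S(1) by simp
      also have "\<dots> \<le> f (rescaled_edge_path N h)"
        using B N K by (intro nearby_inf_le rescaled_edge_path_in_skorohod_paths skorohod_dist_rescaled_edge_path_le)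
      finally show ?thesis .
    next
      case False
      then have "(\<Sum>B\<in>S. ?g B * indicator (edge_pattern N L B) h) = 0" by (intro sum.neutral) auto
      then show ?thesis using f[OF rescaled_edge_path_in_skorohod_paths] by simp
    qed
  qed
  finally show ?thesis .
qed

end

section \<open>Convergence\<close>

lemma integral_half_square:
  fixes s t :: real
  assumes "s \<le> t"
  shows "integral {s..t} (\<lambda>u. u\<^sup>2 / 2) = (t ^ 3 - s ^ 3) / 6"
proof -
  have "((\<lambda>u. u\<^sup>2 / 2) has_integral (t ^ 3 / 6 - s ^ 3 / 6)) {s..t}"
    using assms
    by (intro fundamental_theorem_of_calculus)
      (auto intro!: derivative_eq_intros simp flip: has_real_derivative_iff_has_vector_derivative)
  from integral_unique[OF this] show ?thesis by (simp only: diff_divide_distrib)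
qed

lemma increment_mean_le: "i < L \<Longrightarrow> increment_mean N i \<le> real L ^ 2 / (2 * real N)"
proof -
  assume "i < L"
  then have "(real i + 1) ^ 2 \<le> real L ^ 2" by (intro power_mono) auto
  then have "(3 * real i ^ 2 + 3 * real i + 1) / (6 * real N) \<le> (3 * real L ^ 2) / (6 * real N)"
    by (intro divide_right_mono) (auto simp: power2_sum)
  then show ?thesis by (simp add: increment_mean_def)
qed

section \<open>The limit process and the comparison of expectations\<close>

locale edge_limit_process = nonhomogeneous_poisson_process M "\<lambda>t. t\<^sup>2 / 2" Y
  for M :: "'a measure" and Y

context edge_limit_process
begin

lemma cell_mean_eq: "0 < N \<Longrightarrow> cell_mean (root 3 (real N)) i = increment_mean N i"
proof -
  assume N: "0 < N"
  then have "root 3 (real N) ^ 3 = real N" by simp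
  then have "cell_mean (root 3 (real N)) i = (real (Suc i) ^ 3 / real N - real i ^ 3 / real N) / 6"
    unfolding cell_mean_def using N
    by (subst integral_half_square) (auto intro!: divide_right_mono simp: power_divide simp del: of_nat_Suc)
  also have "\<dots> = (real (Suc i) ^ 3 - real i ^ 3) / (6 * real N)"
    by (simp add: diff_divide_distrib)
  also have "real (Suc i) ^ 3 - real i ^ 3 = 3 * real i ^ 2 + 3 * real i + 1"
    by (simp add: power3_eq_cube power2_eq_square algebra_simps)
  finally show ?thesis by (simp add: increment_mean_def)
qed

definition sampled_path :: "nat \<Rightarrow> nat \<Rightarrow> 'a \<Rightarrow> real \<Rightarrow> real" where
  "sampled_path N L \<omega> = (\<lambda>t\<in>{0..}. real (sampled (root 3 (real N)) L (\<lambda>t. Y t \<omega>) t))"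

lemma sampled_path_in_skorohod_paths: "sampled_path N L \<omega> \<in> skorohod_paths"
  unfolding sampled_path_def by (rule sampled_in_skorohod_paths) simp

text \<open>Here \<open>g\<close> is arbitrary. This serves \<open>nearby_inf f\<close>, an infimum
  over a whole ball of paths.\<close>

lemma sampled_path_measurable: "(\<lambda>\<omega>. g (sampled_path N L \<omega>)) \<in> borel_measurable M"
proof (rule borel_measurableI)
  fix S
  have "sampled_path N L -` (g -` S) \<inter> space M \<in> sets M"
    unfolding sampled_path_def[abs_def] by (intro sampled_vimage_measurable random_variable) auto
  then show "(\<lambda>\<omega>. g (sampled_path N L \<omega>)) -` S \<inter> space M \<in> sets M" by (simp add: vimage_def)
qed

lemma sampled_path_eq_pattern_path:
  "\<omega> \<in> count_pattern (root 3 (real N)) L B \<Longrightarrow> sampled_path N L \<omega> = pattern_path (root 3 (real N)) L B"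
  by (auto simp: sampled_path_def pattern_path_def sampled_def count_pattern_def)

definition not_sparse :: "nat \<Rightarrow> nat \<Rightarrow> real \<Rightarrow> real \<Rightarrow> 'a set" where
  "not_sparse N L I k =
    space M - (\<Union>B\<in>sparse_patterns L I k. count_pattern (root 3 (real N)) L B)"

lemma prob_not_sparse_le':
  assumes N: "0 < N" and k: "0 < k" and I: "0 \<le> I"
  shows "prob (not_sparse N L I k) \<le>
    real L * (real L ^ 2 / (2 * real N)) ^ 2 + (I + 1) ^ 3 / (6 * real N) + real L ^ 3 / (6 * real N) / k"
proof -
  let ?m = "increment_mean N"
  have "prob (not_sparse N L I k) \<le>
    (\<Sum>i<L. ?m i ^ 2) + (\<Sum>i\<in>{i. i < L \<and> real i < I}. ?m i) + (\<Sum>i<L. ?m i) / k"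
    using prob_not_sparse_le[of "root 3 (real N)" k L I] N k
    by (simp add: not_sparse_def cell_mean_eq)
  also have "(\<Sum>i<L. ?m i ^ 2) \<le> (\<Sum>i<L. (real L ^ 2 / (2 * real N)) ^ 2)"
    by (intro sum_mono power_mono increment_mean_le increment_mean_nonneg) simp
  \<comment> \<open>Rounding the cutoff up to an integer makes the sum telescope and turns
    \<open>I\<close> into \<open>I + 1\<close> in the bound.\<close>
  also have "(\<Sum>i\<in>{i. i < L \<and> real i < I}. ?m i) \<le> (\<Sum>i<nat \<lceil>I\<rceil>. ?m i)"
    by (intro sum_mono2 increment_mean_nonneg) (auto, linarith)
  also have "\<dots> = real (nat \<lceil>I\<rceil>) ^ 3 / (6 * real N)" by (rule sum_increment_mean)
  also have "\<dots> \<le> (I + 1) ^ 3 / (6 * real N)"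
    using I by (intro divide_right_mono power_mono) linarith+
  finally show ?thesis by (simp add: sum_increment_mean)
qed

context
  fixes f :: "(real \<Rightarrow> real) \<Rightarrow> real" and C :: real
  assumes f: "\<And>x. x \<in> skorohod_paths \<Longrightarrow> 0 \<le> f x \<and> f x \<le> C"
begin

text \<open>On a sparse pattern event the envelope takes a value determined by \<open>B\<close>, so
  the sum over patterns carries over from the law of \<open>Y\<close> to that of \<open>X\<close>.
  On the remaining outcomes of \<open>Y\<close> the bound \<open>C\<close> is paid.\<close>

lemma expectation_nearby_inf_le:
  assumes N: "0 < N" "2 * L \<le> N" and K: "real K \<le> real L / root 3 (real N)"
    and I: "1 \<le> I" and k: "0 < k" and small: "7 / (3 * I) + 2 * k / I ^ 2 \<le> 1"
    and c: "0 \<le> pattern_ratio N L I k"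
  shows "pattern_ratio N L I k *
      (expectation (\<lambda>\<omega>. nearby_inf f ((1/2) ^ K) (sampled_path N L \<omega>)) - C * prob (not_sparse N L I k))
    \<le> measure_pmf.expectation (full_history N) (\<lambda>h. f (rescaled_edge_path N h))"
proof -
  define a where "a = root 3 (real N)"
  have a: "0 < a" using N by (simp add: a_def)
  define S where "S = sparse_patterns L I k"
  have S: "finite S" by (simp add: S_def finite_sparse_patterns)
  let ?g = "\<lambda>B. nearby_inf f ((1/2) ^ K) (pattern_path a L B)"
  have pp: "pattern_path a L B \<in> skorohod_paths" for B
    unfolding pattern_path_def using a
    by (intro step_path_in_skorohod_paths[where F = "\<lambda>i. real (card (B \<inter> {..<min i L}))"]) simp
  have C: "0 \<le> C" using f[OF pp] by (meson order_trans)
  have ev: "count_pattern a L B \<in> events" for B using a by (rule count_pattern_event)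
  have nev: "not_sparse N L I k \<in> events"
    unfolding not_sparse_def a_def[symmetric] S_def[symmetric]
    by (intro sets.Diff sets.finite_UN S ev) auto
  have "expectation (\<lambda>\<omega>. nearby_inf f ((1/2) ^ K) (sampled_path N L \<omega>)) \<le>
      expectation (\<lambda>\<omega>. (\<Sum>B\<in>S. ?g B * indicator (count_pattern a L B) \<omega>) + C * indicator (not_sparse N L I k) \<omega>)"
  proof (rule integral_mono)
    show "integrable M (\<lambda>\<omega>. nearby_inf f ((1/2) ^ K) (sampled_path N L \<omega>))"
      using nearby_inf_bounds[of f C, OF f sampled_path_in_skorohod_paths, where \<delta> = "(1/2) ^ K"]
      by (intro integrable_const_bound[where B = C] sampled_path_measurable) auto
    show "integrable M (\<lambda>\<omega>. (\<Sum>B\<in>S. ?g B * indicator (count_pattern a L B) \<omega>) + C * indicator (not_sparse N L I k) \<omega>)"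
      using ev nev by (auto intro!: Bochner_Integration.integrable_add Bochner_Integration.integrable_sum
          integrable_mult_right integrable_real_indicator simp: emeasure_eq_measure)
    fix \<omega> assume \<omega>: "\<omega> \<in> space M"
    have g0: "0 \<le> ?g B * indicator (count_pattern a L B) \<omega>" for B
      using nearby_inf_bounds(1)[of f C, OF f pp] by simp
    show "nearby_inf f ((1/2) ^ K) (sampled_path N L \<omega>) \<le>
      (\<Sum>B\<in>S. ?g B * indicator (count_pattern a L B) \<omega>) + C * indicator (not_sparse N L I k) \<omega>"
    proof (cases "\<exists>B\<in>S. \<omega> \<in> count_pattern a L B")
      case True
      then obtain B where B: "B \<in> S" "\<omega> \<in> count_pattern a L B" by blast
      then have "nearby_inf f ((1/2) ^ K) (sampled_path N L \<omega>) = ?g B * indicator (count_pattern a L B) \<omega>"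
        using sampled_path_eq_pattern_path[of \<omega> N L B] by (simp add: a_def)
      also have "\<dots> \<le> (\<Sum>B\<in>S. ?g B * indicator (count_pattern a L B) \<omega>)"
        using B(1) g0 S by (intro member_le_sum) auto
      finally show ?thesis using C by (simp add: add_increasing2)
    next
      case False
      then have "\<omega> \<in> not_sparse N L I k" using \<omega> by (auto simp: not_sparse_def a_def S_def)
      moreover have "0 \<le> (\<Sum>B\<in>S. ?g B * indicator (count_pattern a L B) \<omega>)"
        by (intro sum_nonneg g0)
      moreover have "nearby_inf f ((1/2) ^ K) (sampled_path N L \<omega>) \<le> C"
        by (intro nearby_inf_bounds(2)[of f C, OF f sampled_path_in_skorohod_paths]) auto
      ultimately show ?thesis by (simp add: add_increasing)
    qed
  qed
  also have "\<dots> = (\<Sum>B\<in>S. ?g B * prob (count_pattern a L B)) + C * prob (not_sparse N L I k)"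
    using ev nev by (subst Bochner_Integration.integral_add)
      (auto intro!: Bochner_Integration.integrable_sum integrable_mult_right integrable_real_indicator
        simp: emeasure_eq_measure Bochner_Integration.integral_sum)
  finally have "pattern_ratio N L I k *
      (expectation (\<lambda>\<omega>. nearby_inf f ((1/2) ^ K) (sampled_path N L \<omega>)) - C * prob (not_sparse N L I k))
      \<le> pattern_ratio N L I k * (\<Sum>B\<in>S. ?g B * prob (count_pattern a L B))"
    by (intro mult_left_mono c) simp
  also have "\<dots> = (\<Sum>B\<in>S. ?g B * (pattern_ratio N L I k * prob (count_pattern a L B)))"
    by (simp add: sum_distrib_left mult_ac)
  also have "\<dots> \<le> (\<Sum>B\<in>S. ?g B * measure_pmf.prob (full_history N) (edge_pattern N L B))"
  proof (intro sum_mono mult_left_mono)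
    fix B assume "B \<in> S"
    then show "pattern_ratio N L I k * prob (count_pattern a L B) \<le>
        measure_pmf.prob (full_history N) (edge_pattern N L B)"
      using pattern_ratio_le[OF N I _ small, of B] N k
      by (simp add: S_def prob_count_pattern[OF a[unfolded a_def]] a_def cell_mean_eq cong: if_cong)
    show "0 \<le> ?g B" using nearby_inf_bounds(1)[of f C, OF f pp] by simp
  qed
  also have "\<dots> \<le> measure_pmf.expectation (full_history N) (\<lambda>h. f (rescaled_edge_path N h))"
    unfolding a_def using N K S
    by (intro expectation_rescaled_edge_path_ge[of f C, OF f]) (auto simp: S_def sparse_patterns_def)
  finally show ?thesis .
qed

text \<open>Continuity at \<open>x\<close> gives a ball of radius \<open>r\<close> on which
  \<open>f\<close> is nearly constant. Eventually it contains the ball around \<open>y n\<close>, as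
  the distance to the centre and the radius \<open>\<delta> n\<close> are both below r / 2.\<close>

lemma tendsto_nearby_inf:
  assumes cont: "continuous_map skorohod_topology euclideanreal f" and x: "x \<in> skorohod_paths"
    and y: "\<And>n. y n \<in> skorohod_paths" and xy: "(\<lambda>n. skorohod_dist x (y n)) \<longlonglongrightarrow> 0"
    and \<delta>: "\<And>n. 0 \<le> \<delta> n" "\<delta> \<longlonglongrightarrow> 0"
  shows "(\<lambda>n. nearby_inf f (\<delta> n) (y n)) \<longlonglongrightarrow> f x"
proof (rule tendstoI)
  fix e :: real assume e: "0 < e"
  have "openin skorohod_topology {z \<in> skorohod_paths. f z \<in> ball (f x) (e / 2)}"
    using openin_continuous_map_preimage[OF cont, of "ball (f x) (e / 2)"]
    by (simp add: skorohod_topology_def)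
  then obtain r where r: "0 < r" "Skorohod.mball x r \<subseteq> {z \<in> skorohod_paths. f z \<in> ball (f x) (e / 2)}"
    using x e unfolding skorohod_topology_def Skorohod.openin_mtopology by (metis (mono_tags, lifting) centre_in_ball half_gt_zero mem_Collect_eq)
  have near: "\<bar>f z - f x\<bar> < e / 2" if "z \<in> skorohod_paths" "skorohod_dist x z < r" for z
    using r(2) that x by (auto simp: dist_real_def subset_iff abs_minus_commute)
  have "0 < r / 2" using r(1) by simp
  then have "\<forall>\<^sub>F n in sequentially. skorohod_dist x (y n) < r / 2" "\<forall>\<^sub>F n in sequentially. \<delta> n < r / 2"
    by (rule order_tendstoD(2)[OF xy], rule order_tendstoD(2)[OF \<delta>(2)])
  then show "\<forall>\<^sub>F n in sequentially. dist (nearby_inf f (\<delta> n) (y n)) (f x) < e"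
  proof eventually_elim
    case (elim n)
    have "f x - e / 2 \<le> nearby_inf f (\<delta> n) (y n)"
    proof (rule nearby_inf_ge[of f C, OF f y \<delta>(1)])
      fix z assume z: "z \<in> skorohod_paths" "skorohod_dist z (y n) \<le> \<delta> n"
      have "skorohod_dist x z \<le> skorohod_dist x (y n) + skorohod_dist z (y n)"
        using Skorohod.triangle[OF x y z(1), of n] Skorohod.commute[of z "y n"] by simp
      then have "skorohod_dist x z < r" using elim z by simp
      then show "f x - e / 2 \<le> f z" using near[OF z(1)] by linarith
    qed
    moreover have "nearby_inf f (\<delta> n) (y n) \<le> f (y n)"
      using y \<delta>(1) by (intro nearby_inf_le[of f C, OF f]) auto
    moreover have "\<bar>f (y n) - f x\<bar> < e / 2" using near[OF y] elim r(1) by simp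
    ultimately show ?case using e unfolding dist_real_def by linarith
  qed
qed

text \<open>The liminf inequality, phrased with a threshold \<open>v\<close> below the limit as
  \<open>order_tendstoI\<close> consumes it.\<close>

lemma eventually_expectation_gt:
  assumes cont: "continuous_map skorohod_topology euclideanreal f"
    and v: "v < expectation (\<lambda>\<omega>. f (\<lambda>t\<in>{0..}. real (Y t \<omega>)))"
  shows "\<forall>\<^sub>F N in sequentially.
    v < measure_pmf.expectation (full_history N) (\<lambda>h. f (rescaled_edge_path N h))"
proof -
  \<comment> \<open>The exponents make all of these errors vanish: L^5 / N^2 is of order N^(-1/6),
    I^3 / N, L^3 / (N k) and k / I are of order N^(-1/10), k^2 / I^2 is of order N^(-1/5), k L^2 / N
    of order N^(-1/15), and L^4 / N^2 of order N^(-8/15). At the same time the horizon L / N^(1/3)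
    grows like N^(1/30).\<close>
  define L where "L N = nat \<lfloor>real N powr (11/30)\<rfloor>" for N :: nat
  define I where "I N = real N powr (3/10)" for N :: nat
  define k where "k N = real N powr (1/5)" for N :: nat
  define K where "K N = nat \<lfloor>real (L N) / root 3 (real N)\<rfloor>" for N
  define r where "r N = pattern_ratio N (L N) (I N) (k N)" for N
  define g where "g N \<omega> = nearby_inf f ((1/2) ^ K N) (sampled_path N (L N) \<omega>)" for N \<omega>
  have limL: "filterlim (\<lambda>N. real (L N) / root 3 (real N)) at_top sequentially"
    unfolding L_def by real_asymp
  have limK: "(\<lambda>N. (1/2) ^ K N :: real) \<longlonglongrightarrow> 0"
  proof -
    have "filterlim K at_top sequentially"
      unfolding K_def[abs_def] L_def by real_asymp
    then show ?thesis
      by (intro filterlim_compose[OF LIMSEQ_power_zero[of "1/2::real"]]) auto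
  qed
  have path: "(\<lambda>t\<in>{0..}. real (Y t \<omega>)) \<in> skorohod_paths" if "\<omega> \<in> space M" for \<omega>
    using counting_path_sample[OF that] by (rule counting_path_in_skorohod_paths)
  have "(\<lambda>N. expectation (g N)) \<longlonglongrightarrow> expectation (\<lambda>\<omega>. f (\<lambda>t\<in>{0..}. real (Y t \<omega>)))"
  proof (rule integral_dominated_convergence[where w = "\<lambda>_. C"])
    show "(\<lambda>\<omega>. f (\<lambda>t\<in>{0..}. real (Y t \<omega>))) \<in> borel_measurable M"
      by (rule measurable_compose[OF measurable_path borel_measurable_continuous_map[OF cont]])
    show "g N \<in> borel_measurable M" for N
      unfolding g_def[abs_def] by (rule sampled_path_measurable)
    show "AE \<omega> in M. norm (g N \<omega>) \<le> C" for N
      using nearby_inf_bounds[of f C, OF f sampled_path_in_skorohod_paths, where \<delta> = "(1/2) ^ K N"]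
      by (auto simp: g_def)
    show "AE \<omega> in M. (\<lambda>N. g N \<omega>) \<longlonglongrightarrow> f (\<lambda>t\<in>{0..}. real (Y t \<omega>))"
    proof (rule AE_I2)
      fix \<omega> assume \<omega>: "\<omega> \<in> space M"
      have "(\<lambda>N. skorohod_dist (\<lambda>t\<in>{0..}. real (Y t \<omega>)) (sampled_path N (L N) \<omega>)) \<longlonglongrightarrow> 0"
        unfolding sampled_path_def
        by (intro tendsto_skorohod_dist_sampled counting_path_sample \<omega> limL) real_asymp
      then show "(\<lambda>N. g N \<omega>) \<longlonglongrightarrow> f (\<lambda>t\<in>{0..}. real (Y t \<omega>))"
        unfolding g_def using limK
        by (intro tendsto_nearby_inf cont path \<omega> sampled_path_in_skorohod_paths) auto
    qed
  qed simp
  moreover have "r \<longlonglongrightarrow> 1"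
  proof -
    have "(\<lambda>N. real (L N) ^ 3 / (6 * real N) * (real (L N) / (real N - real (L N)))) \<longlonglongrightarrow> 0"
      unfolding L_def by real_asymp
    moreover have "(\<lambda>N. k N * (1 - success_factor N (L N) (I N) (k N))) \<longlonglongrightarrow> 0"
      unfolding success_factor_def L_def I_def k_def by real_asymp
    ultimately have "r \<longlonglongrightarrow> exp (- 0) * (1 - 0)"
      unfolding r_def[abs_def] pattern_ratio_def by (intro tendsto_intros)
    then show ?thesis by simp
  qed
  moreover have "(\<lambda>N. prob (not_sparse N (L N) (I N) (k N))) \<longlonglongrightarrow> 0"
  proof (rule tendsto_sandwich[where f = "\<lambda>_. 0"])
    show "\<forall>\<^sub>F N in sequentially. prob (not_sparse N (L N) (I N) (k N)) \<le>
      real (L N) * (real (L N) ^ 2 / (2 * real N)) ^ 2 + (I N + 1) ^ 3 / (6 * real N)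
        + real (L N) ^ 3 / (6 * real N) / k N"
      using eventually_gt_at_top[of 0]
      by eventually_elim (intro prob_not_sparse_le', auto simp: I_def k_def)
    show "(\<lambda>N. real (L N) * (real (L N) ^ 2 / (2 * real N)) ^ 2 + (I N + 1) ^ 3 / (6 * real N)
        + real (L N) ^ 3 / (6 * real N) / k N) \<longlonglongrightarrow> 0"
      unfolding L_def I_def k_def by real_asymp
  qed auto
  ultimately have "(\<lambda>N. r N * (expectation (g N) - C * prob (not_sparse N (L N) (I N) (k N))))
      \<longlonglongrightarrow> 1 * (expectation (\<lambda>\<omega>. f (\<lambda>t\<in>{0..}. real (Y t \<omega>))) - C * 0)"
    by (intro tendsto_intros)
  then have "\<forall>\<^sub>F N in sequentially.
      v < r N * (expectation (g N) - C * prob (not_sparse N (L N) (I N) (k N)))"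
    using v by (intro order_tendstoD(1)) auto
  moreover have "\<forall>\<^sub>F N in sequentially. 0 < r N"
    using \<open>r \<longlonglongrightarrow> 1\<close> by (rule order_tendstoD(1)) simp
  moreover have "\<forall>\<^sub>F N in sequentially. 2 * real (L N) \<le> real N"
    unfolding L_def by real_asymp
  moreover have "\<forall>\<^sub>F N in sequentially. 1 \<le> I N" unfolding I_def by real_asymp
  moreover have "\<forall>\<^sub>F N in sequentially. 7 / (3 * I N) + 2 * k N / I N ^ 2 \<le> 1"
    unfolding I_def k_def by real_asymp
  moreover have "\<forall>\<^sub>F N in sequentially. 0 < N" by (rule eventually_gt_at_top)
  ultimately show ?thesis
  proof eventually_elim
    case (elim N)
    have "r N * (expectation (g N) - C * prob (not_sparse N (L N) (I N) (k N)))
      \<le> measure_pmf.expectation (full_history N) (\<lambda>h. f (rescaled_edge_path N h))"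
      unfolding r_def g_def[abs_def]
    proof (rule expectation_nearby_inf_le)
      show "real (K N) \<le> real (L N) / root 3 (real N)"
        unfolding K_def by (rule of_nat_floor) simp
    qed (use elim in \<open>auto simp: k_def r_def\<close>)
    then show ?case using elim by linarith
  qed
qed

end

end

theorem theorem2:
  fixes M :: "'a measure" and Y :: "real \<Rightarrow> 'a \<Rightarrow> nat"
  assumes "nonhomogeneous_poisson_process M (\<lambda>t. t\<^sup>2 / 2) Y"
  shows "weak_convergence skorohod_topology edge_process_law (path_law M Y)"
proof -
  interpret edge_limit_process M Y
    using assms by (simp add: edge_limit_process_def)
  let ?T = skorohod_topology
  let ?y = "\<lambda>\<omega>. \<lambda>t\<in>{0..}. real (Y t \<omega>)"
  have top: "topspace ?T = skorohod_paths" by (simp add: skorohod_topology_def)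
  \<comment> \<open>All sets are measurable for a pmf, so only the range of the map has to be
    checked.\<close>
  have rm: "rescaled_edge_path N \<in> measure_pmf (full_history N) \<rightarrow>\<^sub>M borel_of ?T" for N
    by (auto simp: top rescaled_edge_path_in_skorohod_paths)
  have lim: "(\<lambda>N. integral\<^sup>L (edge_process_law N) f) \<longlonglongrightarrow> integral\<^sup>L (path_law M Y) f"
    if f: "continuous_map ?T euclideanreal f" "bounded (f ` topspace ?T)" for f
  proof -
    have fm: "f \<in> borel_measurable (borel_of ?T)" using f(1) by (rule borel_measurable_continuous_map)
    obtain C where C: "\<And>x. x \<in> skorohod_paths \<Longrightarrow> \<bar>f x\<bar> \<le> C"
      using f(2) by (auto simp: bounded_iff top)
    define E where "E N = measure_pmf.expectation (full_history N) (\<lambda>h. f (rescaled_edge_path N h))" for N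
    have E: "integral\<^sup>L (edge_process_law N) f = E N" for N
      unfolding edge_process_law_def E_def by (rule integral_distr[OF rm fm])
    have Ey: "integral\<^sup>L (path_law M Y) f = expectation (\<lambda>\<omega>. f (?y \<omega>))"
      unfolding path_law_def by (rule integral_distr[OF measurable_path fm])
    have int1: "integrable (measure_pmf (full_history N)) (\<lambda>h. f (rescaled_edge_path N h))" for N
      using C[OF rescaled_edge_path_in_skorohod_paths]
      by (intro measure_pmf.integrable_const_bound[where B = C]) auto
    have int2: "integrable M (\<lambda>\<omega>. f (?y \<omega>))"
      using C counting_path_in_skorohod_paths[OF counting_path_sample]
      by (intro integrable_const_bound[where B = C] AE_I2 measurable_compose[OF measurable_path fm]) auto
    show ?thesis
      unfolding E Ey
    proof (rule order_tendstoI)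
      fix v assume v: "v < expectation (\<lambda>\<omega>. f (?y \<omega>))"
      have "\<forall>\<^sub>F N in sequentially. C + v <
          measure_pmf.expectation (full_history N) (\<lambda>h. C + f (rescaled_edge_path N h))"
      proof (rule eventually_expectation_gt[where C = "2 * C"])
        show "0 \<le> C + f x \<and> C + f x \<le> 2 * C" if "x \<in> skorohod_paths" for x
          using C[OF that] by linarith
        show "continuous_map ?T euclideanreal (\<lambda>x. C + f x)"
          using f(1) by (intro continuous_intros) auto
        show "C + v < expectation (\<lambda>\<omega>. C + f (?y \<omega>))"
          using v int2 by (simp add: prob_space)
      qed
      then show "\<forall>\<^sub>F N in sequentially. v < E N"
        using int1 by (simp add: E_def)
    next
      fix v assume v: "expectation (\<lambda>\<omega>. f (?y \<omega>)) < v"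
      have "\<forall>\<^sub>F N in sequentially. C - v <
          measure_pmf.expectation (full_history N) (\<lambda>h. C - f (rescaled_edge_path N h))"
      proof (rule eventually_expectation_gt[where C = "2 * C"])
        show "0 \<le> C - f x \<and> C - f x \<le> 2 * C" if "x \<in> skorohod_paths" for x
          using C[OF that] by linarith
        show "continuous_map ?T euclideanreal (\<lambda>x. C - f x)"
          using f(1) by (intro continuous_intros) auto
        show "C - v < expectation (\<lambda>\<omega>. C - f (?y \<omega>))"
          using v int2 by (simp add: prob_space)
      qed
      then show "\<forall>\<^sub>F N in sequentially. E N < v"
        using int1 by (simp add: E_def)
    qed
  qed
  show ?thesis
    unfolding weak_convergence_def
    using lim by (auto simp: edge_process_law_def path_law_def
        intro!: measure_pmf.prob_space_distr rm prob_space_distr measurable_path)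
qed

end
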